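(* Suppose that the scaling limit of the crossing probability of a rectangle exists for independent critical site percolation on $\mathbb{Z}^2_{cp}$ and is given by a continuous function $F$ of the aspect ratio; that is, suppose there is a continuous function $F$ such that, at $p=p_c^*$, for all $b,h>0$, $\lim_{\delta\to 0}\phi^*_\delta(b,h;0)=F(\rho)$ with $\rho=b/h$. Then the corresponding crossing probability in the bootstrapped model $\bar\omega$ with $p=p_c^*$ has the same scaling limit, i.e., for all $b,h>0$, $\lim_{\delta\to 0}\bar\phi^*_\delta(b,h)=F(\rho)$ with $\rho=b/h$.
   Context: Two sites of $\mathbb{Z}^2$ are neighbors if they are at Euclidean distance $1$. The initial configuration $\omega=\omega_0\in\{0,1\}^{\mathbb{Z}^2}$ is chosen according to $P_p$, the product of Bernoulli measures with parameter $p$ (each site is independently $1$ with probability $p$). The bootstrap dynamics is deterministic, in discrete time, with simultaneous updates: $1$'s remain $1$ forever, and a $0$ becomes $1$ at the next update if and only if it has at least three neighbors (out of four) that are $1$. $\omega_n$ is the configuration after $n$ updates and $\bar\omega=\omega_\infty=\lim_n\omega_n$ is the final (bootstrapped) configuration (the limit exists by monotonicity). Sites with value $1$ are called open. $\mathbb{Z}^2_{cp}$ is the close-packed version of $\mathbb{Z}^2$, obtained by adding the two diagonals to each face of $\mathbb{Z}^2$ (so each site has eight neighbors). Two sites are $*$-neighbors if they are neighbors in $\mathbb{Z}^2_{cp}$. A $*$-path is an ordered sequence of distinct sites, consecutive ones being $*$-neighbors. $p_c^*$ is the critical value of independent site percolation on $\mathbb{Z}^2_{cp}$; it equals $1-p_c$,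 where $p_c$ is the critical value of independent site percolation on $\mathbb{Z}^2$. Crossing probabilities: for $b,h>0$ let $\mathcal{R}=\mathcal{R}(b,h)=(-b/2,b/2)\times(-h/2,h/2)\subset\mathbb{R}^2$, with aspect ratio $\rho=b/h$. For mesh $\delta>0$, there is a vertical open $*$-crossing of $\mathcal{R}$ at time $n$ if there is a $*$-path $(x_0,x_1,\ldots,x_m,x_{m+1})$ in $\mathbb{Z}^2$ such that $\omega_n(x_j)=1$ for all $j$, the points $\delta x_1,\ldots,\delta x_m$ are all in $\mathcal{R}$, and the line segments $\overline{\delta x_0,\delta x_1}$ and $\overline{\delta x_m,\delta x_{m+1}}$ touch respectively the top side $[-b/2,b/2]\times\{h/2\}$ and the bottom side $[-b/2,b/2]\times\{-h/2\}$ of $\mathcal{R}$. $\phi^*_\delta(b,h;n)$ denotes the probability of such a crossing at time $n$ (so $n=0$ is independent percolation), and $\bar\phi^*_\delta(b,h)$ the probability of such a crossing for $\bar\omega$ (i.e. $n=\infty$). *)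

theory Defs
  imports "HOL-Probability.Probability"
begin

type_synonym site = "int \<times> int"

text \<open>The value \<^const>\<open>True\<close> stands for 1 (open), \<^const>\<open>False\<close> for 0 (closed).\<close>
type_synonym config = "site \<Rightarrow> bool"

definition pt :: "site \<Rightarrow> real \<times> real" where
  "pt x = (real_of_int (fst x), real_of_int (snd x))"

text \<open>The metric on \<^typ>\<open>real \<times> real\<close> is the Euclidean one.\<close>
definition neighbor :: "site \<Rightarrow> site \<Rightarrow> bool" where
  "neighbor x y \<longleftrightarrow> dist (pt x) (pt y) = 1"

definition star_neighbor :: "site \<Rightarrow> site \<Rightarrow> bool" where
  "star_neighbor x y \<longleftrightarrow>
     neighbor x y \<or> (\<bar>fst x - fst y\<bar> = 1 \<and> \<bar>snd x - snd y\<bar> = 1)"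

definition site_path :: "(site \<Rightarrow> site \<Rightarrow> bool) \<Rightarrow> site list \<Rightarrow> bool" where
  "site_path adj xs \<longleftrightarrow> xs \<noteq> [] \<and> distinct xs \<and> successively adj xs"

definition bernoulli_config :: "real \<Rightarrow> config measure" where
  "bernoulli_config p = (\<Pi>\<^sub>M x\<in>UNIV. measure_pmf (bernoulli_pmf p))"

definition open_cluster :: "(site \<Rightarrow> site \<Rightarrow> bool) \<Rightarrow> config \<Rightarrow> site \<Rightarrow> site set" where
  "open_cluster adj \<omega> x =
     {y. \<exists>xs. site_path adj xs \<and> hd xs = x \<and> last xs = y \<and> (\<forall>z\<in>set xs. \<omega> z)}"

definition percolation_prob :: "(site \<Rightarrow> site \<Rightarrow> bool) \<Rightarrow> real \<Rightarrow> real" where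
  "percolation_prob adj p =
     \<P>(\<omega> in bernoulli_config p. infinite (open_cluster adj \<omega> (0, 0)))"

definition critical_prob :: "(site \<Rightarrow> site \<Rightarrow> bool) \<Rightarrow> real" where
  "critical_prob adj = Sup {p \<in> {0..1}. percolation_prob adj p = 0}"

definition pc_star :: real where
  "pc_star = critical_prob star_neighbor"

definition bootstrap_step :: "config \<Rightarrow> config" where
  "bootstrap_step \<omega> x \<longleftrightarrow> \<omega> x \<or> 3 \<le> card {y. neighbor x y \<and> \<omega> y}"

definition bootstrap :: "nat \<Rightarrow> config \<Rightarrow> config" where
  "bootstrap n \<omega> = (bootstrap_step ^^ n) \<omega>"

definition bootstrap_limit :: "config \<Rightarrow> config" where
  "bootstrap_limit \<omega> x = lim (\<lambda>n. bootstrap n \<omega> x)"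

lemma bootstrap_mono:
  assumes "m \<le> n" "bootstrap m \<omega> x"
  shows "bootstrap n \<omega> x"
  using assms by (induction rule: dec_induct) (auto simp: bootstrap_def bootstrap_step_def)

lemma bootstrap_tendsto:
  "(\<lambda>n. bootstrap n \<omega> x) \<longlonglongrightarrow> (\<exists>n. bootstrap n \<omega> x)"
proof (rule tendsto_eventually)
  show "\<forall>\<^sub>F n in sequentially. bootstrap n \<omega> x = (\<exists>n. bootstrap n \<omega> x)"
    unfolding eventually_sequentially by (metis bootstrap_mono)
qed

lemma bootstrap_limit_iff: "bootstrap_limit \<omega> x \<longleftrightarrow> (\<exists>n. bootstrap n \<omega> x)"
  unfolding bootstrap_limit_def using limI[OF bootstrap_tendsto] by simp

definition rect :: "real \<Rightarrow> real \<Rightarrow> (real \<times> real) set" where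
  "rect b h = {-b/2<..<b/2} \<times> {-h/2<..<h/2}"

definition top_side :: "real \<Rightarrow> real \<Rightarrow> (real \<times> real) set" where
  "top_side b h = {-b/2..b/2} \<times> {h/2}"

definition bottom_side :: "real \<Rightarrow> real \<Rightarrow> (real \<times> real) set" where
  "bottom_side b h = {-b/2..b/2} \<times> {-h/2}"

text \<open>The list \<open>xs\<close> is the path \<open>(x\<^sub>0, x\<^sub>1, \<dots>, x\<^sub>m, x\<^sub>m\<^sub>+\<^sub>1)\<close>.
  The restriction \<open>m \<ge> 1\<close> matters only for coarse meshes, \<open>\<delta> \<ge> h\<close>.\<close>
definition vertical_star_crossing :: "real \<Rightarrow> real \<Rightarrow> real \<Rightarrow> config \<Rightarrow> bool" where
  "vertical_star_crossing \<delta> b h \<eta> \<longleftrightarrow>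
     (\<exists>m xs. 1 \<le> m \<and> length xs = m + 2 \<and> site_path star_neighbor xs
        \<and> (\<forall>j\<in>{0..m+1}. \<eta> (xs ! j))
        \<and> (\<forall>j\<in>{1..m}. \<delta> *\<^sub>R pt (xs ! j) \<in> rect b h)
        \<and> closed_segment (\<delta> *\<^sub>R pt (xs ! 0)) (\<delta> *\<^sub>R pt (xs ! 1)) \<inter> top_side b h \<noteq> {}
        \<and> closed_segment (\<delta> *\<^sub>R pt (xs ! m)) (\<delta> *\<^sub>R pt (xs ! (m+1))) \<inter> bottom_side b h \<noteq> {})"

definition crossing_prob :: "real \<Rightarrow> real \<Rightarrow> real \<Rightarrow> real \<Rightarrow> nat \<Rightarrow> real" where
  "crossing_prob p \<delta> b h n =
     \<P>(\<omega> in bernoulli_config p. vertical_star_crossing \<delta> b h (bootstrap n \<omega>))"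

definition crossing_prob_limit :: "real \<Rightarrow> real \<Rightarrow> real \<Rightarrow> real \<Rightarrow> real" where
  "crossing_prob_limit p \<delta> b h =
     \<P>(\<omega> in bernoulli_config p. vertical_star_crossing \<delta> b h (bootstrap_limit \<omega>))"

end

theory Submission
  imports Defs "HOL-Real_Asymp.Real_Asymp"
begin

text \<open>
  Monotonicity of the dynamics gives one half: an initial crossing is a final crossing, so the
  limit inferior of the final crossing probabilities is at least \<open>F (b / h)\<close>.
  For the other half, a crossing of the final configuration is turned into a crossing of the
  initial configuration in a slightly wider and slightly shorter rectangle. Continuity of \<open>F\<close>
  then closes the gap.

  Geometry. When a site opens, at least three of its four neighbours are already open, and any
  three of them form a \<open>*\<close>-connected set through which every \<open>*\<close>-path visiting the new site can
  be rerouted. Hence one step of the dynamics creates no new \<open>*\<close>-connections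
  (\<open>star_connected_step_back\<close>): undoing the step moves a path, including its two ends, by at most
  one lattice unit. Undoing \<open>n\<close> steps moves it by at most \<open>n\<close> units
  (\<open>star_connected_bootstrap\<close>), which is macroscopically negligible when \<open>n\<close> is a small multiple
  of \<open>1 / \<delta>\<close>. It remains to exclude that some site in a box of side \<open>O(1 / \<delta>)\<close> opens later
  than that.

  Late openings are exponentially unlikely. If \<open>x\<close> opens at step \<open>k\<close>, at most one neighbour
  \<open>z\<close> of \<open>x\<close> is still closed, and the initially closed cluster \<open>T\<close> of \<open>x\<close> in the lattice
  without \<open>z\<close> is a finite tree of depth of order \<open>k\<close> that is eroded from its leaves. Such a
  \<open>T\<close> contains no fully closed \<open>2 \<times> 2\<close> block, since such a block never opens. So all of the
  roughly \<open>k / 4\<close> or more blocks that \<open>T\<close> touches are prevented from being full, although each block is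
  full with a fixed probability \<open>q\<^sup>4\<close>, where \<open>q\<close> is the density of closed sites.

  To make this quantitative without exploring the cluster step by step, each event ``the cluster
  is \<open>T\<close>'' is intersected with the event that the blocks of a large window not touched by \<open>T\<close>
  are not full (\<open>sum_cluster_events\<close>). These intersections are still disjoint and all lie in the
  event that no block of the window is full, which has probability \<open>(1 - q\<^sup>4)\<^sup>M\<close> for \<open>M\<close> blocks;
  the extra requirement costs only the factors \<open>1 - q\<^sup>4\<close> of the untouched blocks. Comparing the
  two sides leaves one factor \<open>1 - q\<^sup>4\<close> for every touched block.
\<close>

section \<open>Neighbours and single steps of the dynamics\<close>

lemma neighbor_iff:
  "neighbor x y \<longleftrightarrow>
     y \<in> {(fst x + 1, snd x), (fst x - 1, snd x), (fst x, snd x + 1), (fst x, snd x - 1)}"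
proof -
  obtain s t where y: "y = (fst x + s, snd x + t)" by (metis add.commute diff_add_cancel prod.collapse)
  have "neighbor x y \<longleftrightarrow> real_of_int (s\<^sup>2 + t\<^sup>2) = real_of_int 1"
    by (simp add: neighbor_def pt_def y dist_Pair_Pair dist_real_def)
  also have "\<dots> \<longleftrightarrow> s\<^sup>2 + t\<^sup>2 = 1"
    by (simp only: of_int_eq_iff)
  also have "\<dots> \<longleftrightarrow> (s, t) \<in> {(1, 0), (-1, 0), (0, 1), (0, -1)}"
  proof
    assume st: "s\<^sup>2 + t\<^sup>2 = 1"
    have "s\<^sup>2 \<le> 1" "t\<^sup>2 \<le> 1"
      using st zero_le_power2[of s] zero_le_power2[of t] by linarith+
    then have "\<bar>s\<bar> \<le> 1" "\<bar>t\<bar> \<le> 1" by (simp_all add: abs_square_le_1)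
    then have "s \<in> {-1, 0, 1}" "t \<in> {-1, 0, 1}" by auto
    with st show "(s, t) \<in> {(1, 0), (-1, 0), (0, 1), (0, -1)}" by auto
  qed auto
  also have "\<dots> \<longleftrightarrow> y \<in> {(fst x + 1, snd x), (fst x - 1, snd x), (fst x, snd x + 1), (fst x, snd x - 1)}"
    by (auto simp: y)
  finally show ?thesis .
qed

lemma neighbor_sym: "neighbor x y \<longleftrightarrow> neighbor y x"
  by (simp add: neighbor_def dist_commute)

lemma not_neighbor_self [simp]: "\<not> neighbor x x"
  by (simp add: neighbor_def)

lemma neighbors_eq:
  "{y. neighbor x y} = {(fst x + 1, snd x), (fst x - 1, snd x), (fst x, snd x + 1), (fst x, snd x - 1)}"
  by (auto simp: neighbor_iff)

lemma card_neighbors: "card {y. neighbor x y} = 4" "finite {y. neighbor x y}"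
  unfolding neighbors_eq by auto

text \<open>
  At least three of four neighbours are open exactly when no two distinct ones are closed; in this
  form the rule can be used without counting.
\<close>
lemma bootstrap_step_iff:
  "bootstrap_step \<omega> x \<longleftrightarrow>
     \<omega> x \<or> (\<forall>u v. neighbor x u \<and> neighbor x v \<and> \<not> \<omega> u \<and> \<not> \<omega> v \<longrightarrow> u = v)"
proof -
  let ?O = "{y. neighbor x y \<and> \<omega> y}" and ?C = "{y. neighbor x y \<and> \<not> \<omega> y}"
  have fin: "finite ?O" "finite ?C"
    by (rule finite_subset[OF _ card_neighbors(2)[of x]]; blast)+
  have "?O \<union> ?C = {y. neighbor x y}" "?O \<inter> ?C = {}" by auto
  then have "card ?O + card ?C = 4"
    using card_Un_disjoint[OF fin] card_neighbors(1)[of x] by simp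
  then have "3 \<le> card ?O \<longleftrightarrow> card ?C \<le> Suc 0" by linarith
  also have "\<dots> \<longleftrightarrow> (\<forall>u\<in>?C. \<forall>v\<in>?C. u = v)"
    by (rule card_le_Suc0_iff_eq[OF fin(2)])
  finally show ?thesis unfolding bootstrap_step_def by blast
qed

lemma bootstrap_0 [simp]: "bootstrap 0 \<omega> = \<omega>"
  by (simp add: bootstrap_def)

lemma bootstrap_Suc: "bootstrap (Suc n) \<omega> = bootstrap_step (bootstrap n \<omega>)"
  by (simp add: bootstrap_def)

definition flips :: "config \<Rightarrow> nat \<Rightarrow> site \<Rightarrow> bool" where
  "flips \<omega> n x \<longleftrightarrow> \<not> bootstrap n \<omega> x \<and> bootstrap (Suc n) \<omega> x"

lemma flips_if_open_later:
  assumes "\<not> bootstrap m \<omega> x" "bootstrap n \<omega> x"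
  obtains k where "m \<le> k" "k < n" "flips \<omega> k x"
proof -
  have "m < n" using assms bootstrap_mono by (metis not_le_imp_less)
  from assms have "\<exists>k. m \<le> k \<and> k < n \<and> flips \<omega> k x"
  proof (induction n)
    case 0 then show ?case using bootstrap_mono by blast
  next
    case (Suc n)
    have "m \<le> n" using Suc.prems bootstrap_mono by (metis not_less_eq_eq)
    show ?case
    proof (cases "bootstrap n \<omega> x")
      case True then show ?thesis using Suc by (meson less_SucI)
    next
      case False then show ?thesis using Suc.prems \<open>m \<le> n\<close> unfolding flips_def by blast
    qed
  qed
  then show ?thesis using that by blast
qed

lemma flips_closed: "flips \<omega> n x \<Longrightarrow> m \<le> n \<Longrightarrow> \<not> bootstrap m \<omega> x"
  unfolding flips_def using bootstrap_mono by blast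

lemma flips_unique: "flips \<omega> n x \<Longrightarrow> flips \<omega> m x \<Longrightarrow> n = m"
  unfolding flips_def using bootstrap_mono by (meson not_less_eq_eq nle_le)

lemma flips_unique_closed_neighbor:
  assumes "flips \<omega> n x" "neighbor x u" "neighbor x v" "\<not> bootstrap n \<omega> u" "\<not> bootstrap n \<omega> v"
  shows "u = v"
  using assms unfolding flips_def bootstrap_Suc bootstrap_step_iff by blast

lemma flips_Suc_neighbors:
  assumes "flips \<omega> (Suc n) x"
  obtains u v where "neighbor x u" "neighbor x v" "u \<noteq> v"
    "\<not> bootstrap n \<omega> u" "\<not> bootstrap n \<omega> v"
  using assms unfolding flips_def bootstrap_Suc[of n] bootstrap_step_iff by blast

lemma flips_child:
  assumes "flips \<omega> (Suc n) x"
  obtains u where "neighbor x u" "flips \<omega> n u"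
  using flips_Suc_neighbors[OF assms] flips_unique_closed_neighbor[OF assms]
  unfolding flips_def by metis

text \<open>
  The site \<open>z\<close> is the only neighbour through which \<open>x\<close> may be attached to sites that are still closed. If some
  neighbour is still closed when \<open>x\<close> opens, it is \<open>z\<close>. Otherwise \<open>z\<close> is one of the at least two
  neighbours that were closed one step earlier, which leaves another such neighbour \<open>u\<close> to
  continue the chain of openings.
\<close>
lemma flips_parent:
  assumes "flips \<omega> (Suc n) x"
  obtains z u where "neighbor x z" "\<not> bootstrap n \<omega> z"
    "\<And>v. neighbor x v \<Longrightarrow> v \<noteq> z \<Longrightarrow> bootstrap (Suc n) \<omega> v"
    "neighbor x u" "u \<noteq> z" "flips \<omega> n u"
proof -
  obtain u v where uv: "neighbor x u" "neighbor x v" "u \<noteq> v"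
    "\<not> bootstrap n \<omega> u" "\<not> bootstrap n \<omega> v"
    using flips_Suc_neighbors[OF assms] by metis
  note uq = flips_unique_closed_neighbor[OF assms]
  show ?thesis
  proof (cases "\<exists>z. neighbor x z \<and> \<not> bootstrap (Suc n) \<omega> z")
    case True
    then obtain z where z: "neighbor x z" "\<not> bootstrap (Suc n) \<omega> z" by blast
    then have "\<not> bootstrap n \<omega> z" using bootstrap_mono le_SucI by blast
    moreover have "bootstrap (Suc n) \<omega> v" if "neighbor x v" "v \<noteq> z" for v
      using z uq that by blast
    moreover obtain w where "neighbor x w" "w \<noteq> z" "\<not> bootstrap n \<omega> w" using uv by metis
    ultimately show ?thesis using that z by (metis flips_def)
  next
    case False
    then have fl: "flips \<omega> n u" using uv unfolding flips_def by blast
    show ?thesis by (rule that[of v u]) (use uv False fl in blast)+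
  qed
qed

section \<open>The closed tree behind a late opening\<close>

definition closed_rel :: "config \<Rightarrow> site \<Rightarrow> site rel" where
  "closed_rel \<omega> z = {(a, b). neighbor a b \<and> \<not> \<omega> a \<and> \<not> \<omega> b \<and> a \<noteq> z \<and> b \<noteq> z}"

text \<open>
  The site \<open>z\<close> stands for the one neighbour that may still be closed when \<open>x\<close> opens. Removing it
  leaves the connected component of \<open>x\<close> that has to be eroded before \<open>x\<close> can open.
\<close>
definition closed_cluster :: "config \<Rightarrow> site \<Rightarrow> site \<Rightarrow> site set" where
  "closed_cluster \<omega> z x = (closed_rel \<omega> z)\<^sup>* `` {x}"

lemma closed_cluster_self: "x \<in> closed_cluster \<omega> z x"
  by (simp add: closed_cluster_def)

lemma closed_cluster_step:
  "a \<in> closed_cluster \<omega> z x \<Longrightarrow> (a, b) \<in> closed_rel \<omega> z \<Longrightarrow> b \<in> closed_cluster \<omega> z x"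
  unfolding closed_cluster_def by (auto intro: rtrancl_into_rtrancl)

lemma closed_cluster_induct [consumes 1, case_names base step]:
  assumes "y \<in> closed_cluster \<omega> z x" "P x"
    "\<And>a b. a \<in> closed_cluster \<omega> z x \<Longrightarrow> (a, b) \<in> closed_rel \<omega> z \<Longrightarrow> P a \<Longrightarrow> P b"
  shows "P y"
proof -
  have "(x, y) \<in> (closed_rel \<omega> z)\<^sup>*" using assms(1) by (simp add: closed_cluster_def)
  then show ?thesis
  proof (induction rule: rtrancl_induct)
    case base then show ?case using assms by simp
  next
    case (step a b) then show ?case using assms(3)[of a b] by (simp add: closed_cluster_def)
  qed
qed

lemma closed_cluster_closed:
  "\<not> \<omega> x \<Longrightarrow> x \<noteq> z \<Longrightarrow> y \<in> closed_cluster \<omega> z x \<Longrightarrow> \<not> \<omega> y \<and> y \<noteq> z"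
  by (erule closed_cluster_induct) (auto simp: closed_rel_def)

definition boundary :: "site set \<Rightarrow> site \<Rightarrow> site set" where
  "boundary T z = {v. v \<notin> T \<and> v \<noteq> z \<and> (\<exists>y\<in>T. neighbor y v)}"

lemma boundary_open:
  assumes "\<not> \<omega> x" "x \<noteq> z" "v \<in> boundary (closed_cluster \<omega> z x) z"
  shows "\<omega> v"
proof (rule ccontr)
  assume "\<not> \<omega> v"
  from assms(3) obtain y where y: "y \<in> closed_cluster \<omega> z x" "neighbor y v"
    "v \<notin> closed_cluster \<omega> z x" "v \<noteq> z" unfolding boundary_def by blast
  then have "(y, v) \<in> closed_rel \<omega> z"
    using closed_cluster_closed[OF assms(1,2) y(1)] \<open>\<not> \<omega> v\<close> by (auto simp: closed_rel_def)
  then show False using closed_cluster_step y by blast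
qed

text \<open>
  The event that the cluster equals a possible value \<open>T\<close> is a cylinder event: it says that the
  sites of \<open>T\<close> are closed and those of its boundary are open. In particular the cylinder
  events of different values of \<open>T\<close> are disjoint.
\<close>
lemma closed_cluster_eqI:
  assumes T: "T = closed_cluster \<omega>' z x"
    and cl: "\<forall>y\<in>T. \<not> \<omega> y" and op: "\<forall>v\<in>boundary T z. \<omega> v"
  shows "closed_cluster \<omega> z x = T"
proof
  show "closed_cluster \<omega> z x \<subseteq> T"
  proof
    fix y assume "y \<in> closed_cluster \<omega> z x"
    then show "y \<in> T"
    proof (induction rule: closed_cluster_induct)
      case base then show ?case by (simp add: T closed_cluster_self)
    next
      case (step a b)
      then show ?case using op unfolding boundary_def closed_rel_def by blast
    qed
  qed
  show "T \<subseteq> closed_cluster \<omega> z x"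
  proof
    fix y assume "y \<in> T"
    then show "y \<in> closed_cluster \<omega> z x" unfolding T
    proof (induction rule: closed_cluster_induct)
      case base then show ?case by (simp add: closed_cluster_self)
    next
      case (step a b)
      then have "b \<in> T" unfolding T by (blast intro: closed_cluster_step)
      with step have "(a, b) \<in> closed_rel \<omega> z"
        using cl unfolding closed_rel_def T by blast
      with step show ?case by (blast intro: closed_cluster_step)
    qed
  qed
qed

text \<open>
  Non-backtracking walks of closed sites that start at \<open>x\<close> away from \<open>z\<close>, recorded by their last
  step. Remembering the previous site is what makes the opening times decrease along the walk.
\<close>
inductive branch :: "config \<Rightarrow> site \<Rightarrow> site \<Rightarrow> site \<Rightarrow> site \<Rightarrow> bool" for \<omega> z x where
  root: "branch \<omega> z x z x"
| child: "branch \<omega> z x w y \<Longrightarrow> neighbor y u \<Longrightarrow> u \<noteq> w \<Longrightarrow> \<not> \<omega> u \<Longrightarrow> branch \<omega> z x y u"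

text \<open>
  When \<open>y\<close> opens, its predecessor \<open>w\<close> is still closed and uses up the only closed neighbour that
  \<open>y\<close> may have; so the other neighbours opened strictly earlier, and the argument repeats at each
  of them. The opening time drops at each step, which bounds the distance to \<open>x\<close>.
\<close>
lemma branch_flips:
  assumes "flips \<omega> k x" "neighbor x z"
    and op: "\<And>v. neighbor x v \<Longrightarrow> v \<noteq> z \<Longrightarrow> bootstrap k \<omega> v"
    and "branch \<omega> z x w y"
  shows "\<exists>m\<le>k. flips \<omega> m y \<and> neighbor y w
           \<and> (\<forall>u. neighbor y u \<and> u \<noteq> w \<longrightarrow> bootstrap m \<omega> u)
           \<and> \<bar>fst y - fst x\<bar> \<le> int (k - m) \<and> \<bar>snd y - snd x\<bar> \<le> int (k - m)"
  using assms(4)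
proof induction
  case root
  then show ?case using assms(1,2) op by (intro exI[of _ k]) auto
next
  case (child w y u)
  then obtain m where m: "m \<le> k" "flips \<omega> m y"
    "\<forall>u. neighbor y u \<and> u \<noteq> w \<longrightarrow> bootstrap m \<omega> u"
    "\<bar>fst y - fst x\<bar> \<le> int (k - m)" "\<bar>snd y - snd x\<bar> \<le> int (k - m)" by blast
  have "bootstrap m \<omega> u" using m child by blast
  then obtain l where l: "l < m" "flips \<omega> l u"
    using flips_if_open_later[of 0 \<omega> u m] child by auto
  have yl: "\<not> bootstrap l \<omega> y" using flips_closed[OF m(2)] l by simp
  have "neighbor u y" using child neighbor_sym by blast
  have "\<bar>fst u - fst y\<bar> \<le> 1" "\<bar>snd u - snd y\<bar> \<le> 1"
    using child(2) by (auto simp: neighbor_iff)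
  with l m have "\<bar>fst u - fst x\<bar> \<le> int (k - l)" "\<bar>snd u - snd x\<bar> \<le> int (k - l)"
    by linarith+
  moreover have "bootstrap l \<omega> v" if "neighbor u v" "v \<noteq> y" for v
    using flips_unique_closed_neighbor[OF l(2) \<open>neighbor u y\<close> _ yl] that by blast
  ultimately show ?case using l m \<open>neighbor u y\<close> by (intro exI[of _ l]) auto
qed

lemma branch_parent: "branch \<omega> z x w y \<Longrightarrow> w = z \<or> (\<exists>w'. branch \<omega> z x w' w)"
  by (erule branch.cases) auto

lemma closed_cluster_branch:
  "y \<in> closed_cluster \<omega> z x \<Longrightarrow> \<exists>w. branch \<omega> z x w y"
proof (induction rule: closed_cluster_induct)
  case base then show ?case by (blast intro: branch.root)
next
  case (step a b)
  then obtain w where w: "branch \<omega> z x w a" by blast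
  show ?case
  proof (cases "b = w")
    case True
    then show ?thesis using branch_parent[OF w] step(2) by (auto simp: closed_rel_def)
  next
    case False
    moreover have "neighbor a b" "\<not> \<omega> b" using step(2) by (simp_all add: closed_rel_def)
    ultimately show ?thesis using branch.child[OF w] by blast
  qed
qed

lemma flips_closed_cluster:
  assumes "flips \<omega> k x" "neighbor x z"
    and "\<And>v. neighbor x v \<Longrightarrow> v \<noteq> z \<Longrightarrow> bootstrap k \<omega> v"
    and "y \<in> closed_cluster \<omega> z x"
  obtains m where "flips \<omega> m y" "\<bar>fst y - fst x\<bar> \<le> int k" "\<bar>snd y - snd x\<bar> \<le> int k"
proof -
  obtain w where "branch \<omega> z x w y" using closed_cluster_branch[OF assms(4)] by blast
  from branch_flips[OF assms(1-3) this] that show ?thesis by fastforce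
qed

text \<open>
  A site that opens at some positive time has a neighbour that opened exactly one step before.
  Following these neighbours from \<open>u\<close> down to time \<open>0\<close> yields sites of the cluster with pairwise
  different opening times.
\<close>
lemma card_closed_cluster:
  assumes "flips \<omega> (Suc n) x" "\<not> bootstrap n \<omega> z" "neighbor x u" "u \<noteq> z" "flips \<omega> n u" "x \<noteq> z"
    and fin: "finite (closed_cluster \<omega> z x)"
  shows "n \<le> card (closed_cluster \<omega> z x)"
proof -
  let ?T = "closed_cluster \<omega> z x"
  have xcl: "\<not> \<omega> x" using flips_closed[OF assms(1), of 0] by simp
  have "\<exists>y\<in>?T. flips \<omega> m y" if "m \<le> n" for m
    using that
  proof (induction rule: inc_induct)
    case base
    have "\<not> \<omega> u" using flips_closed[OF assms(5), of 0] by simp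
    then have "(x, u) \<in> closed_rel \<omega> z" using assms xcl by (simp add: closed_rel_def)
    then show ?case using assms closed_cluster_step closed_cluster_self by blast
  next
    case (step m)
    then obtain y where y: "y \<in> ?T" "flips \<omega> (Suc m) y" by blast
    obtain v where v: "neighbor y v" "flips \<omega> m v" using flips_child[OF y(2)] by blast
    have "v \<noteq> z"
    proof
      assume "v = z"
      then have "bootstrap (Suc m) \<omega> z" using v(2) by (simp add: flips_def)
      then show False using assms(2) step(2) bootstrap_mono[of "Suc m" n \<omega> z] by simp
    qed
    moreover have "\<not> \<omega> v" using flips_closed[OF v(2), of 0] by simp
    ultimately have "(y, v) \<in> closed_rel \<omega> z"
      using v closed_cluster_closed[OF xcl assms(6) y(1)] by (simp add: closed_rel_def)
    then show ?case using y v closed_cluster_step by blast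
  qed
  then obtain f where f: "\<And>m. m \<le> n \<Longrightarrow> f m \<in> ?T \<and> flips \<omega> m (f m)" by metis
  have "inj_on f {..<n}"
  proof (rule inj_onI)
    fix i j assume ij: "i \<in> {..<n}" "j \<in> {..<n}" "f i = f j"
    then have "flips \<omega> i (f i)" "flips \<omega> j (f i)" using f[of i] f[of j] by auto
    then show "i = j" by (rule flips_unique)
  qed
  moreover have "f ` {..<n} \<subseteq> ?T" using f by (auto simp: less_imp_le)
  ultimately show ?thesis using card_inj_on_le[OF _ _ fin] by fastforce
qed

section \<open>Two by two blocks\<close>

definition block :: "int \<times> int \<Rightarrow> site set" where
  "block c = {2 * fst c, 2 * fst c + 1} \<times> {2 * snd c, 2 * snd c + 1}"

definition block_of :: "site \<Rightarrow> int \<times> int" where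
  "block_of s = (fst s div 2, snd s div 2)"

lemma mem_block_iff: "s \<in> block c \<longleftrightarrow> block_of s = c"
  unfolding block_def block_of_def by (cases s; cases c) auto

lemma card_block: "card (block c) = 4" "finite (block c)"
  unfolding block_def by (auto simp: card_cartesian_product)

lemma block_two_neighbors:
  assumes "s \<in> block c"
  obtains u v where "u \<in> block c" "v \<in> block c" "u \<noteq> v" "neighbor s u" "neighbor s v"
proof -
  obtain i j where s: "s = (i, j)" by fastforce
  obtain a b where c: "c = (a, b)" by fastforce
  have "i \<in> {2*a, 2*a+1}" "j \<in> {2*b, 2*b+1}" using assms s c by (auto simp: block_def)
  then show ?thesis
    \<comment> \<open>\<open>t \<mapsto> 4 * a + 1 - t\<close> exchanges the two coordinates \<open>2 * a\<close> and \<open>2 * a + 1\<close> of the block.\<close>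
    using that[of "(i, 4*b+1-j)" "(4*a+1-i, j)"] s c
    by (auto simp: block_def neighbor_iff)
qed

text \<open>
  Each site of a closed block has two closed neighbours in the block, so it never sees three open
  ones.
\<close>
lemma closed_block_stable:
  assumes "\<forall>s\<in>block c. \<not> \<omega> s" "s \<in> block c"
  shows "\<not> bootstrap n \<omega> s"
  using assms(2)
proof (induction n arbitrary: s)
  case 0 then show ?case using assms(1) by simp
next
  case (Suc n)
  obtain u v where "u \<in> block c" "v \<in> block c" "u \<noteq> v" "neighbor s u" "neighbor s v"
    using block_two_neighbors[OF Suc.prems] by blast
  then show ?case using Suc unfolding bootstrap_Suc bootstrap_step_iff by blast
qed

lemma block_connected:
  assumes "s \<in> block c" "s \<in> T" "\<And>a b. a \<in> block c \<Longrightarrow> b \<in> block c \<Longrightarrow> a \<in> T \<Longrightarrow> neighbor a b \<Longrightarrow> b \<in> T"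
  shows "block c \<subseteq> T"
proof -
  obtain i j where s: "s = (i, j)" by fastforce
  obtain a b where c: "c = (a, b)" by fastforce
  have ij: "i \<in> {2*a, 2*a+1}" "j \<in> {2*b, 2*b+1}" using assms s c by (auto simp: block_def)
  let ?i = "4*a+1-i" and ?j = "4*b+1-j"
  have in': "(i, ?j) \<in> block c" "(?i, j) \<in> block c" "(?i, ?j) \<in> block c"
    using ij by (auto simp: block_def c)
  have nb: "neighbor (i, j) (i, ?j)" "neighbor (i, j) (?i, j)" "neighbor (i, ?j) (?i, ?j)"
    using ij by (auto simp: neighbor_iff)
  have "block c = {(i, j), (i, ?j), (?i, j), (?i, ?j)}"
    using ij by (auto simp: block_def c)
  moreover have "(i, ?j) \<in> T" using assms(3)[OF _ in'(1) _ nb(1)] assms(1,2) s by simp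
  moreover have "(?i, j) \<in> T" using assms(3)[OF _ in'(2) _ nb(2)] assms(1,2) s by simp
  moreover have "(?i, ?j) \<in> T" using assms(3)[OF in'(1,3) _ nb(3)] calculation by simp
  ultimately show ?thesis using assms(2) s by simp
qed

section \<open>Cylinder events and closed clusters under the product measure\<close>

lemma space_bernoulli_config [simp]: "space (bernoulli_config p) = UNIV"
  by (simp add: bernoulli_config_def space_PiM)

lemma prob_space_bernoulli_config: "prob_space (bernoulli_config p)"
  unfolding bernoulli_config_def by (rule prob_space_PiM) (rule prob_space_measure_pmf)

lemma measurable_site [measurable]: "Measurable.pred (bernoulli_config p) (\<lambda>\<omega>. \<omega> x)"
proof -
  have "(\<lambda>\<omega>. \<omega> x) \<in> bernoulli_config p \<rightarrow>\<^sub>M measure_pmf (bernoulli_pmf p)"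
    unfolding bernoulli_config_def by (rule measurable_component_singleton) simp
  then show ?thesis by simp
qed

lemma measurable_bootstrap [measurable]:
  "Measurable.pred (bernoulli_config p) (\<lambda>\<omega>. bootstrap n \<omega> x)"
proof (induction n arbitrary: x)
  case 0 then show ?case by simp
next
  case (Suc n)
  note Suc[measurable]
  show ?case unfolding bootstrap_Suc bootstrap_step_iff by measurable
qed

lemma measurable_flips [measurable]:
  "Measurable.pred (bernoulli_config p) (\<lambda>\<omega>. flips \<omega> n x)"
  unfolding flips_def by measurable

abbreviation closed_prob :: "real \<Rightarrow> real" where
  "closed_prob p \<equiv> pmf (bernoulli_pmf p) False"

lemma cylinder_prob:
  assumes "finite T" "finite U" "T \<inter> U = {}"
  shows "measure (bernoulli_config p) {\<omega>. (\<forall>y\<in>T. \<not> \<omega> y) \<and> (\<forall>v\<in>U. \<omega> v)}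
           = closed_prob p ^ card T * (1 - closed_prob p) ^ card U"
proof -
  interpret product_prob_space "\<lambda>_::site. measure_pmf (bernoulli_pmf p)" UNIV
    by unfold_locales
  let ?X = "\<lambda>i. if i \<in> T then {False} else {True}"
  have T1: "pmf (bernoulli_pmf p) True = 1 - closed_prob p"
    using pmf_False_conv_True by force
  have X: "\<omega> i \<in> ?X i \<longleftrightarrow> (\<omega> i \<longleftrightarrow> i \<notin> T)" for \<omega> i by simp
  have "emb UNIV (T \<union> U) (Pi\<^sub>E (T \<union> U) ?X) = {\<omega>. \<forall>i\<in>T \<union> U. \<omega> i \<longleftrightarrow> i \<notin> T}"
    by (intro set_eqI) (simp add: prod_emb_iff PiE_iff X del: split_paired_All)
  also have "\<dots> = {\<omega>. (\<forall>y\<in>T. \<not> \<omega> y) \<and> (\<forall>v\<in>U. \<omega> v)}"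
    using assms(3) by blast
  finally have "emb UNIV (T \<union> U) (Pi\<^sub>E (T \<union> U) ?X) = {\<omega>. (\<forall>y\<in>T. \<not> \<omega> y) \<and> (\<forall>v\<in>U. \<omega> v)}" .
  then have "measure (bernoulli_config p) {\<omega>. (\<forall>y\<in>T. \<not> \<omega> y) \<and> (\<forall>v\<in>U. \<omega> v)}
      = (\<Prod>i\<in>T \<union> U. measure (measure_pmf (bernoulli_pmf p)) (?X i))"
    unfolding bernoulli_config_def using measure_PiM_emb[of "T \<union> U" ?X] assms by simp
  also have "\<dots> = (\<Prod>i\<in>T. measure (measure_pmf (bernoulli_pmf p)) (?X i)) *
                  (\<Prod>i\<in>U. measure (measure_pmf (bernoulli_pmf p)) (?X i))"
    using assms by (intro prod.union_disjoint)
  also have "(\<Prod>i\<in>T. measure (measure_pmf (bernoulli_pmf p)) (?X i)) = (\<Prod>i\<in>T. closed_prob p)"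
    by (intro prod.cong) (auto simp: measure_pmf_single)
  also have "(\<Prod>i\<in>U. measure (measure_pmf (bernoulli_pmf p)) (?X i)) = (\<Prod>i\<in>U. 1 - closed_prob p)"
    using assms(3) by (intro prod.cong) (auto simp: measure_pmf_single T1)
  finally show ?thesis by simp
qed

text \<open>
  Induction over the blocks: the configurations in which the block \<open>c\<close> is not full are all
  configurations minus those in which the sites of \<open>c\<close> join the closed set \<open>T\<close>.
\<close>
lemma cylinder_blocks_prob:
  assumes "finite C" "finite T" "finite U" "T \<inter> U = {}" "\<forall>c\<in>C. block c \<inter> (T \<union> U) = {}"
  shows "measure (bernoulli_config p)
           {\<omega>. (\<forall>y\<in>T. \<not> \<omega> y) \<and> (\<forall>v\<in>U. \<omega> v) \<and> (\<forall>c\<in>C. \<exists>s\<in>block c. \<omega> s)}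
         = closed_prob p ^ card T * (1 - closed_prob p) ^ card U * (1 - closed_prob p ^ 4) ^ card C"
    (is "measure ?M (?E T C) = _")
  using assms
proof (induction C arbitrary: T)
  case empty
  then show ?case using cylinder_prob[of T U p] by simp
next
  case (insert c C)
  interpret prob_space ?M by (rule prob_space_bernoulli_config)
  have meas: "?E S D \<in> sets ?M" if "finite S" "finite D" for S D
  proof -
    have "countable S" "countable U" "countable D" "\<And>c. countable (block c)"
      using that insert.prems card_block by (auto intro: countable_finite)
    then have "Measurable.pred ?M
       (\<lambda>\<omega>. (\<forall>y\<in>S. \<not> \<omega> y) \<and> (\<forall>v\<in>U. \<omega> v) \<and> (\<forall>c\<in>D. \<exists>s\<in>block c. \<omega> s))"
      by (intro pred_intros_logic pred_intros_countable_bounded) measurable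
    then show ?thesis by (simp add: pred_def)
  qed
  have dj: "block c \<inter> block d = {}" if "d \<in> C" for d
    using insert.hyps(2) that by (auto simp: mem_block_iff)
  have "?E T (insert c C) = ?E T C - ?E (T \<union> block c) C"
    by blast
  then have "measure ?M (?E T (insert c C)) = measure ?M (?E T C) - measure ?M (?E (T \<union> block c) C)"
    using meas insert.hyps(1) insert.prems card_block
    by (simp only:) (intro finite_measure_Diff, auto)
  moreover have "measure ?M (?E T C) = closed_prob p ^ card T * (1 - closed_prob p) ^ card U
      * (1 - closed_prob p ^ 4) ^ card C"
    using insert by (intro insert.IH) auto
  moreover have "measure ?M (?E (T \<union> block c) C)
      = closed_prob p ^ card (T \<union> block c) * (1 - closed_prob p) ^ card U
      * (1 - closed_prob p ^ 4) ^ card C"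
    using insert.prems dj card_block by (intro insert.IH) blast+
  moreover have "card (T \<union> block c) = card T + 4"
    using insert.prems card_block[of c] by (subst card_Un_disjoint) auto
  ultimately show ?case using insert.hyps by (simp add: power_add algebra_simps)
qed

text \<open>
  The block of \<open>z\<close> is left out because the state of \<open>z\<close> is not determined by the cluster, so
  that block may be full.
\<close>
definition touched :: "site set \<Rightarrow> site \<Rightarrow> (int \<times> int) set" where
  "touched T z = block_of ` (T \<union> boundary T z) - {block_of z}"

lemma finite_boundary: "finite T \<Longrightarrow> finite (boundary T z)"
  by (rule finite_subset[of _ "\<Union>y\<in>T. {v. neighbor y v}"])
     (auto simp: boundary_def card_neighbors(2))

lemma finite_touched: "finite T \<Longrightarrow> finite (touched T z)"
  by (simp add: touched_def finite_boundary)

text \<open>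
  A touched block either contains a boundary site, which is open, or it meets \<open>T\<close>. In the
  second case, if it had no boundary site, it would lie inside \<open>T\<close>, because it is connected and
  does not contain \<open>z\<close>.
\<close>
lemma touched_block_open:
  assumes "c \<in> touched T z" "\<not> block c \<subseteq> T" "\<forall>v\<in>boundary T z. \<omega> v"
  shows "\<exists>s\<in>block c. \<omega> s"
proof (cases "c \<in> block_of ` boundary T z")
  case True
  then show ?thesis using assms(3) by (auto simp: mem_block_iff)
next
  case False
  then obtain s where s: "s \<in> T" "s \<in> block c" and cz: "c \<noteq> block_of z"
    using assms(1) by (auto simp: touched_def mem_block_iff)
  have "b \<in> T" if "b \<in> block c" "a \<in> T" "neighbor a b" for a b
  proof (rule ccontr)
    assume "b \<notin> T"
    then have "b \<in> boundary T z" using that cz by (auto simp: boundary_def mem_block_iff)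
    then show False using False that by (auto simp: mem_block_iff)
  qed
  then have "block c \<subseteq> T" using block_connected[OF s(2,1)] by blast
  with assms(2) show ?thesis by blast
qed

definition cluster_event :: "site set \<Rightarrow> site \<Rightarrow> config set" where
  "cluster_event T z = {\<omega>. (\<forall>y\<in>T. \<not> \<omega> y) \<and> (\<forall>v\<in>boundary T z. \<omega> v)}"

lemma cluster_event_measurable:
  assumes "finite T"
  shows "cluster_event T z \<in> sets (bernoulli_config p)"
proof -
  have "countable T" "countable (boundary T z)"
    using assms finite_boundary by (auto intro: countable_finite)
  then have "Measurable.pred (bernoulli_config p)
     (\<lambda>\<omega>. (\<forall>y\<in>T. \<not> \<omega> y) \<and> (\<forall>v\<in>boundary T z. \<omega> v))"
    by (intro pred_intros_logic pred_intros_countable_bounded) measurable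
  then show ?thesis by (simp add: pred_def cluster_event_def)
qed

text \<open>
  The heart of the exponential decay. On the event that the cluster is \<open>T\<close> the touched blocks are
  automatically not full. Requiring the same of the other blocks of a finite window \<open>\<Lambda>\<close> costs
  exactly one factor \<open>1 - q\<^sup>4\<close> per untouched block, and the resulting disjoint events lie in the
  event that all blocks of \<open>\<Lambda>\<close> are not full. Dividing by the latter's probability gives one
  factor \<open>1 - q\<^sup>4\<close> per touched block.
\<close>
lemma sum_cluster_events:
  assumes "finite \<T>" "0 < L"
    and T: "\<And>T. T \<in> \<T> \<Longrightarrow> finite T \<and> (\<exists>\<omega>. T = closed_cluster \<omega> z x) \<and> (\<forall>c. \<not> block c \<subseteq> T)
              \<and> L \<le> card (touched T z)"
  shows "(\<Sum>T\<in>\<T>. measure (bernoulli_config p) (cluster_event T z)) \<le> (1 - closed_prob p ^ 4) ^ L"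
proof (cases "\<T> = {}")
  case True
  have "closed_prob p ^ 4 \<le> 1" by (intro power_le_one) (auto simp: pmf_le_1)
  with True show ?thesis by simp
next
  case False
  let ?M = "bernoulli_config p" and ?r = "1 - closed_prob p ^ 4"
  interpret prob_space ?M by (rule prob_space_bernoulli_config)
  define \<Lambda> where "\<Lambda> = (\<Union>T\<in>\<T>. touched T z)"
  define N where "N = (\<lambda>C. {\<omega>::config. \<forall>c\<in>C. \<exists>s\<in>block c. \<omega> s})"
  have r: "0 \<le> ?r" "?r \<le> 1"
    by (auto intro: power_le_one simp: pmf_le_1)
  have fin: "finite \<Lambda>" using assms finite_touched by (auto simp: \<Lambda>_def)
  have sub: "touched T z \<subseteq> \<Lambda>" if "T \<in> \<T>" for T using that by (auto simp: \<Lambda>_def)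
  have prN: "measure ?M (N C) = ?r ^ card C" if "finite C" for C
    using cylinder_blocks_prob[OF that, of "{}" "{}" p] by (simp add: N_def)
  have nt: "block c \<inter> (T \<union> boundary T z) = {}" if "c \<in> \<Lambda> - touched T z" "T \<in> \<T>" for c T
  proof -
    have "c \<noteq> block_of z" using that by (auto simp: \<Lambda>_def touched_def)
    then have "s \<notin> block c" if "s \<in> T \<union> boundary T z" for s
      using \<open>c \<in> \<Lambda> - touched T z\<close> that unfolding touched_def mem_block_iff by blast
    then show ?thesis by blast
  qed
  define G where "G = (\<lambda>T. cluster_event T z \<inter> N (\<Lambda> - touched T z))"
  have NC: "N C \<in> sets ?M" if "finite C" for C
  proof -
    have "countable C" "\<And>c. countable (block c)"
      using that card_block by (auto intro: countable_finite)
    then have "Measurable.pred ?M (\<lambda>\<omega>. \<forall>c\<in>C. \<exists>s\<in>block c. \<omega> s)"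
      by (intro pred_intros_countable_bounded) measurable
    then show ?thesis by (simp add: pred_def N_def)
  qed
  have Gm: "G T \<in> sets ?M" if "T \<in> \<T>" for T
    using that T fin NC cluster_event_measurable by (auto simp: G_def)
  have prG: "measure ?M (G T) = measure ?M (cluster_event T z) * ?r ^ (card \<Lambda> - card (touched T z))"
    if "T \<in> \<T>" for T
  proof -
    have f: "finite T" using T that by blast
    have d: "T \<inter> boundary T z = {}" by (auto simp: boundary_def)
    have "G T = {\<omega>. (\<forall>y\<in>T. \<not> \<omega> y) \<and> (\<forall>v\<in>boundary T z. \<omega> v)
        \<and> (\<forall>c\<in>\<Lambda> - touched T z. \<exists>s\<in>block c. \<omega> s)}"
      by (auto simp: G_def cluster_event_def N_def)
    then have "measure ?M (G T) = measure ?M (cluster_event T z) * ?r ^ card (\<Lambda> - touched T z)"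
      unfolding cluster_event_def
      using cylinder_blocks_prob[of "\<Lambda> - touched T z" T "boundary T z" p] fin f d nt that
        cylinder_prob[of T "boundary T z" p] finite_boundary by simp
    also have "card (\<Lambda> - touched T z) = card \<Lambda> - card (touched T z)"
      using sub[OF that] f by (intro card_Diff_subset finite_touched)
    finally show ?thesis .
  qed
  have GN: "G T \<subseteq> N \<Lambda>" if "T \<in> \<T>" for T
    using T[OF that] touched_block_open[of _ T z]
    by (fastforce simp: G_def N_def cluster_event_def)
  have dj: "disjoint_family_on G \<T>"
  proof (unfold disjoint_family_on_def, intro ballI impI)
    fix S T assume ST: "S \<in> \<T>" "T \<in> \<T>" "S \<noteq> T"
    have "closed_cluster \<omega> z x = T" if "\<omega> \<in> G T" "T \<in> \<T>" for \<omega> T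
      using T[OF that(2)] that(1) closed_cluster_eqI[of T _ z x \<omega>]
      by (auto simp: G_def cluster_event_def)
    with ST show "G S \<inter> G T = {}" by blast
  qed
  have le: "(\<Sum>T\<in>\<T>. measure ?M (G T)) \<le> ?r ^ card \<Lambda>"
  proof -
    have "(\<Sum>T\<in>\<T>. measure ?M (G T)) = measure ?M (\<Union>T\<in>\<T>. G T)"
      using assms(1) Gm dj by (intro finite_measure_finite_Union[symmetric]) auto
    also have "\<dots> \<le> measure ?M (N \<Lambda>)"
      using GN NC[OF fin] by (intro finite_measure_mono) auto
    finally show ?thesis using prN[OF fin] by simp
  qed
  have L\<Lambda>: "L \<le> card \<Lambda>"
  proof -
    obtain T0 where "T0 \<in> \<T>" using False by blast
    then show ?thesis using T[of T0] sub[of T0] card_mono[OF fin] le_trans by blast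
  qed
  \<comment> \<open>If \<open>?r = 0\<close>, the common factor \<open>?r ^ (card \<Lambda> - L)\<close> cannot be cancelled, but then no cluster
    event has positive probability.\<close>
  show ?thesis
  proof (cases "?r = 0")
    case True
    have "measure ?M (cluster_event T z) = 0" if "T \<in> \<T>" for T
    proof -
      have "touched T z \<noteq> {}" using T[OF that] assms(2) by auto
      then obtain c where c: "c \<in> touched T z" by blast
      have "cluster_event T z \<subseteq> N {c}"
        using T[OF that] touched_block_open[OF c] unfolding N_def cluster_event_def by blast
      then have "measure ?M (cluster_event T z) \<le> measure ?M (N {c})"
        using NC by (intro finite_measure_mono) auto
      then show ?thesis using prN[of "{c}"] True by (simp add: measure_le_0_iff)
    qed
    then show ?thesis using r by simp
  next
    case False
    with r have pos: "0 < ?r" by simp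
    have "?r ^ (card \<Lambda> - L) * (\<Sum>T\<in>\<T>. measure ?M (cluster_event T z))
       = (\<Sum>T\<in>\<T>. measure ?M (cluster_event T z) * ?r ^ (card \<Lambda> - L))"
      by (subst mult.commute) (rule sum_distrib_right)
    also have "\<dots> \<le> (\<Sum>T\<in>\<T>. measure ?M (G T))"
    proof (rule sum_mono)
      fix T assume "T \<in> \<T>"
      then have "L \<le> card (touched T z)" using T by blast
      then have "?r ^ (card \<Lambda> - L) \<le> ?r ^ (card \<Lambda> - card (touched T z))"
        using r by (intro power_decreasing diff_le_mono2)
      then show "measure ?M (cluster_event T z) * ?r ^ (card \<Lambda> - L) \<le> measure ?M (G T)"
        using prG[OF \<open>T \<in> \<T>\<close>] by (simp add: mult_left_mono)
    qed
    also have "\<dots> \<le> ?r ^ (card \<Lambda> - L) * ?r ^ L"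
      using le L\<Lambda> by (simp flip: power_add)
    finally show ?thesis using pos by simp
  qed
qed

lemma card_le_touched:
  assumes "finite T"
  shows "card T div 4 - 1 \<le> card (touched T z)"
proof -
  have "T \<subseteq> (\<Union>c\<in>block_of ` T. block c)" by (auto simp: mem_block_iff)
  then have "card T \<le> card (\<Union>c\<in>block_of ` T. block c)"
    using assms card_block by (intro card_mono) auto
  also have "\<dots> \<le> (\<Sum>c\<in>block_of ` T. card (block c))"
    using assms by (intro card_UN_le) auto
  also have "\<dots> = 4 * card (block_of ` T)" by (simp add: card_block)
  finally have "card T div 4 \<le> card (block_of ` T)" by linarith
  also have "\<dots> \<le> card (insert (block_of z) (touched T z))"
    using assms finite_touched by (intro card_mono) (auto simp: touched_def)
  also have "\<dots> \<le> Suc (card (touched T z))"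
    by (rule card_insert_le_m1[THEN le_trans]) (auto simp: card_insert_if finite_touched assms)
  finally show ?thesis by linarith
qed

text \<open>
  Summing over the four choices of \<open>z\<close> and over the possible closed clusters, all of which lie in a
  box around \<open>x\<close> and touch at least \<open>n div 4 - 1\<close> blocks.
\<close>
lemma prob_flips_le:
  "measure (bernoulli_config p) {\<omega>. flips \<omega> (Suc n) x} \<le> 4 * (1 - closed_prob p ^ 4) ^ (n div 4 - 1)"
proof (cases "n div 4 - 1 = 0")
  case True
  interpret prob_space "bernoulli_config p" by (rule prob_space_bernoulli_config)
  show ?thesis
    unfolding True using order_trans[OF prob_le_1, of 4] by simp
next
  case False
  let ?M = "bernoulli_config p" and ?r = "1 - closed_prob p ^ 4" and ?L = "n div 4 - 1"
  interpret prob_space ?M by (rule prob_space_bernoulli_config)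
  define Q where "Q = {fst x - int (Suc n)..fst x + int (Suc n)} \<times> {snd x - int (Suc n)..snd x + int (Suc n)}"
  define \<T> where "\<T> = (\<lambda>z. {T \<in> Pow Q. (\<exists>\<omega>. T = closed_cluster \<omega> z x) \<and> (\<forall>c. \<not> block c \<subseteq> T) \<and> n \<le> card T})"
  have finQ: "finite Q" by (simp add: Q_def)
  have finT: "finite (\<T> z)" for z using finQ by (simp add: \<T>_def)
  have sub: "{\<omega>. flips \<omega> (Suc n) x} \<subseteq> (\<Union>z\<in>{z. neighbor x z}. \<Union>T\<in>\<T> z. cluster_event T z)"
  proof
    fix \<omega> assume "\<omega> \<in> {\<omega>. flips \<omega> (Suc n) x}"
    then have fl: "flips \<omega> (Suc n) x" by simp
    obtain z u where z: "neighbor x z" "\<not> bootstrap n \<omega> z"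
      and op: "\<And>v. neighbor x v \<Longrightarrow> v \<noteq> z \<Longrightarrow> bootstrap (Suc n) \<omega> v"
      and u: "neighbor x u" "u \<noteq> z" "flips \<omega> n u"
      by (rule flips_parent[OF fl]) (rule that)
    let ?T = "closed_cluster \<omega> z x"
    have xz: "x \<noteq> z" using z by auto
    have xcl: "\<not> \<omega> x" using flips_closed[OF fl, of 0] by simp
    have TQ: "?T \<subseteq> Q"
    proof
      fix y assume "y \<in> ?T"
      from flips_closed_cluster[OF fl z(1) op this]
      have "\<bar>fst y - fst x\<bar> \<le> int (Suc n)" "\<bar>snd y - snd x\<bar> \<le> int (Suc n)" by metis+
      then show "y \<in> Q" unfolding Q_def mem_Times_iff atLeastAtMost_iff by linarith
    qed
    have "\<not> block c \<subseteq> ?T" for c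
    proof
      assume b: "block c \<subseteq> ?T"
      obtain s where s: "s \<in> block c" by (auto simp: block_def)
      with b have "s \<in> ?T" by blast
      then obtain m where "flips \<omega> m s" using flips_closed_cluster[OF fl z(1) op] by metis
      moreover have "\<forall>s\<in>block c. \<not> \<omega> s" using closed_cluster_closed[of \<omega> x z, OF xcl xz] b by blast
      ultimately show False using closed_block_stable[OF _ s] by (auto simp: flips_def)
    qed
    moreover have "n \<le> card ?T"
      using card_closed_cluster[OF fl z(2) u xz] TQ finQ finite_subset by blast
    ultimately have "?T \<in> \<T> z" using TQ by (auto simp: \<T>_def)
    moreover have "\<omega> \<in> cluster_event ?T z"
      using closed_cluster_closed[of \<omega> x z, OF xcl xz] boundary_open[of \<omega> x z, OF xcl xz] by (simp add: cluster_event_def)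
    ultimately show "\<omega> \<in> (\<Union>z\<in>{z. neighbor x z}. \<Union>T\<in>\<T> z. cluster_event T z)"
      using z(1) by blast
  qed
  have mT: "cluster_event T z \<in> sets ?M" if "T \<in> \<T> z" for T z
    using that finQ by (intro cluster_event_measurable) (auto simp: \<T>_def intro: finite_subset)
  have "measure ?M {\<omega>. flips \<omega> (Suc n) x}
      \<le> measure ?M (\<Union>z\<in>{z. neighbor x z}. \<Union>T\<in>\<T> z. cluster_event T z)"
    using mT finT card_neighbors(2) sub by (intro finite_measure_mono sets.finite_UN) auto
  also have "\<dots> \<le> (\<Sum>z\<in>{z. neighbor x z}. measure ?M (\<Union>T\<in>\<T> z. cluster_event T z))"
    using mT finT card_neighbors(2) by (intro finite_measure_subadditive_finite) (auto intro!: sets.finite_UN)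
  also have "\<dots> \<le> (\<Sum>z\<in>{z. neighbor x z}. ?r ^ ?L)"
  proof (rule sum_mono)
    fix z
    have "measure ?M (\<Union>T\<in>\<T> z. cluster_event T z) \<le> (\<Sum>T\<in>\<T> z. measure ?M (cluster_event T z))"
      using mT[of _ z] finT[of z] by (intro finite_measure_subadditive_finite) auto
    also have "\<dots> \<le> ?r ^ ?L"
    proof (rule sum_cluster_events[OF finT])
      fix T assume T: "T \<in> \<T> z"
      then have "finite T" using finQ finite_subset by (auto simp: \<T>_def)
      moreover have "?L \<le> card T div 4 - 1"
        using T by (intro diff_le_mono div_le_mono) (auto simp: \<T>_def)
      ultimately show "finite T \<and> (\<exists>\<omega>. T = closed_cluster \<omega> z x) \<and> (\<forall>c. \<not> block c \<subseteq> T)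
          \<and> ?L \<le> card (touched T z)"
        using T card_le_touched[of T z] by (auto simp: \<T>_def)
    qed (use False in simp)
    finally show "measure ?M (\<Union>T\<in>\<T> z. cluster_event T z) \<le> ?r ^ ?L" .
  qed
  finally show ?thesis by (simp add: card_neighbors)
qed

section \<open>Exponential decay of the opening time\<close>

text \<open>
  If closed sites have probability \<open>0\<close>, nothing ever flips; otherwise \<open>1 - q\<^sup>4 < 1\<close>. The maximum
  with \<open>1/2\<close> keeps the base of the powers positive when \<open>q = 1\<close>.
\<close>
lemma prob_flips_exponential:
  obtains C \<rho> where "0 < \<rho>" "\<rho> < 1" "0 \<le> C"
    "\<And>k x. measure (bernoulli_config p) {\<omega>. flips \<omega> k x} \<le> C * \<rho> ^ k"
proof (cases "closed_prob p = 0")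
  case True
  interpret prob_space "bernoulli_config p" by (rule prob_space_bernoulli_config)
  have "measure (bernoulli_config p) {\<omega>. flips \<omega> k x} \<le> 0 * (1/2) ^ k" for k x
  proof -
    have "Measurable.pred (bernoulli_config p) (\<lambda>\<omega>. \<not> \<omega> x)" by measurable
    then have neg: "{\<omega>. \<not> \<omega> x} \<in> sets (bernoulli_config p)" by (simp add: pred_def)
    have "{\<omega>. flips \<omega> k x} \<subseteq> {\<omega>. \<not> \<omega> x}" using flips_closed[of _ k x 0] by auto
    then have "measure (bernoulli_config p) {\<omega>. flips \<omega> k x} \<le> measure (bernoulli_config p) {\<omega>. \<not> \<omega> x}"
      using neg by (intro finite_measure_mono)
    also have "\<dots> = 0" using cylinder_prob[of "{x}" "{}" p] True by simp
    finally show ?thesis by simp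
  qed
  then show ?thesis using that[of "1/2" 0] by simp
next
  case False
  interpret prob_space "bernoulli_config p" by (rule prob_space_bernoulli_config)
  let ?r = "1 - closed_prob p ^ 4"
  define s where "s = max ?r (1/2)"
  have "0 < closed_prob p" using False pmf_nonneg[of "bernoulli_pmf p" False] by linarith
  then have s: "0 < s" "s < 1" by (auto simp: s_def)
  have r: "0 \<le> ?r" by (auto intro: power_le_one simp: pmf_le_1)
  define \<rho> where "\<rho> = s powr (1/4)"
  \<comment> \<open>The exponent makes up for the rounding in \<open>(k - 1) div 4 - 1\<close>, which is at least \<open>k / 4 - 9 / 4\<close>.\<close>
  define C where "C = 4 * s powr (-9/4)"
  have \<rho>: "0 < \<rho>" "\<rho> < 1" using s powr_less_mono2[of "1/4" s 1] by (auto simp: \<rho>_def)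
  have C\<rho>: "C * \<rho> ^ k = 4 * s powr (k / 4 - 9/4)" for k
    using s by (simp add: C_def \<rho>_def powr_powr flip: powr_realpow powr_add)
  have "measure (bernoulli_config p) {\<omega>. flips \<omega> k x} \<le> C * \<rho> ^ k" for k x
  proof (cases k)
    case 0
    have "1 \<le> s powr (-9/4)" using s by (simp add: powr_minus powr_le1 one_le_inverse)
    then show ?thesis using 0 order_trans[OF prob_le_1, of C] by (simp add: C_def)
  next
    case (Suc n)
    have "measure (bernoulli_config p) {\<omega>. flips \<omega> k x} \<le> 4 * ?r ^ (n div 4 - 1)"
      using prob_flips_le[of p n x] Suc by simp
    also have "\<dots> \<le> 4 * s ^ (n div 4 - 1)"
      using r by (intro mult_left_mono power_mono) (auto simp: s_def)
    also have "s ^ (n div 4 - 1) = s powr real (n div 4 - 1)" using s by (simp add: powr_realpow)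
    also have "s powr real (n div 4 - 1) \<le> s powr (k / 4 - 9/4)"
    proof (rule powr_mono')
      have "k \<le> 4 * (n div 4 - 1) + 9" unfolding Suc by presburger
      then have "real k \<le> 4 * real (n div 4 - 1) + 9" by linarith
      then show "k / 4 - 9/4 \<le> real (n div 4 - 1)" by linarith
    qed (use s in auto)
    finally show ?thesis unfolding C\<rho> by simp
  qed
  then show ?thesis using that[of \<rho> C] \<rho> by (simp add: C_def)
qed

definition late_flip :: "nat \<Rightarrow> nat \<Rightarrow> config set" where
  "late_flip K n = {\<omega>. \<exists>x\<in>{-int K..int K} \<times> {-int K..int K}. \<exists>k. n \<le> k \<and> flips \<omega> k x}"

lemma late_flip_prob:
  assumes "0 < \<rho>" "\<rho> < 1" "0 \<le> C"
    and le: "\<And>k x. measure (bernoulli_config p) {\<omega>. flips \<omega> k x} \<le> C * \<rho> ^ k"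
  shows "late_flip K n \<in> sets (bernoulli_config p)"
    and "measure (bernoulli_config p) (late_flip K n) \<le> (2 * real K + 1)\<^sup>2 * (C * \<rho> ^ n / (1 - \<rho>))"
proof -
  let ?M = "bernoulli_config p"
  interpret prob_space ?M by (rule prob_space_bernoulli_config)
  let ?Q = "{-int K..int K} \<times> {-int K..int K}"
  let ?A = "\<lambda>x i. {\<omega>. flips \<omega> (i + n) x}"
  have mA: "?A x i \<in> sets ?M" for x i using measurable_flips[of "i + n" x p] by (simp add: pred_def)
  have eq: "late_flip K n = (\<Union>x\<in>?Q. \<Union>i. ?A x i)"
    unfolding late_flip_def by (auto simp: le_iff_add add.commute)
  have mU: "(\<Union>i. ?A x i) \<in> sets ?M" for x using mA by blast
  show "late_flip K n \<in> sets ?M" unfolding eq by (rule sets.finite_UN) (simp, rule mU)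
  have tail: "measure ?M (\<Union>i. ?A x i) \<le> C * \<rho> ^ n / (1 - \<rho>)" for x
  proof -
    have gs: "summable (\<lambda>i. C * \<rho> ^ n * \<rho> ^ i)"
      using assms by (intro summable_mult summable_geometric) auto
    have b: "measure ?M (?A x i) \<le> C * \<rho> ^ n * \<rho> ^ i" for i
      using le[of "i + n" x] by (simp add: power_add mult_ac)
    have sm: "summable (\<lambda>i. measure ?M (?A x i))"
      by (rule summable_comparison_test[OF _ gs]) (use b in auto)
    have "measure ?M (\<Union>i. ?A x i) \<le> (\<Sum>i. measure ?M (?A x i))"
      by (rule finite_measure_subadditive_countably[OF _ sm]) (rule image_subsetI, rule mA)
    also have "\<dots> \<le> (\<Sum>i. C * \<rho> ^ n * \<rho> ^ i)" using b sm gs by (intro suminf_le)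
    also have "\<dots> = C * \<rho> ^ n / (1 - \<rho>)"
      using assms suminf_mult[of "\<lambda>i. \<rho> ^ i" "C * \<rho> ^ n"]
      by (simp add: suminf_geometric summable_geometric)
    finally show ?thesis .
  qed
  have "measure ?M (late_flip K n) \<le> (\<Sum>x\<in>?Q. measure ?M (\<Union>i. ?A x i))"
    unfolding eq using mU by (intro finite_measure_subadditive_finite) auto
  also have "\<dots> \<le> (\<Sum>x\<in>?Q. C * \<rho> ^ n / (1 - \<rho>))" by (intro sum_mono tail)
  also have "\<dots> = real (card ?Q) * (C * \<rho> ^ n / (1 - \<rho>))" by simp
  also have "real (card ?Q) = (2 * real K + 1)\<^sup>2"
    by (simp add: card_cartesian_product power2_eq_square)
  finally show "measure ?M (late_flip K n) \<le> (2 * real K + 1)\<^sup>2 * (C * \<rho> ^ n / (1 - \<rho>))" .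
qed

section \<open>Rerouting star paths backwards in time\<close>

lemma star_neighbor_iff:
  "star_neighbor a b \<longleftrightarrow> a \<noteq> b \<and> \<bar>fst a - fst b\<bar> \<le> 1 \<and> \<bar>snd a - snd b\<bar> \<le> 1"
proof -
  obtain s t where b: "b = (fst a + s, snd a + t)" by (metis add.commute diff_add_cancel prod.collapse)
  have "star_neighbor a b \<longleftrightarrow> (s, t) \<in> {(1, 0), (-1, 0), (0, 1), (0, -1)} \<or> \<bar>s\<bar> = 1 \<and> \<bar>t\<bar> = 1"
    by (auto simp: star_neighbor_def neighbor_iff b)
  also have "\<dots> \<longleftrightarrow> (s, t) \<noteq> (0, 0) \<and> s \<in> {-1, 0, 1} \<and> t \<in> {-1, 0, 1}"
    by auto
  also have "\<dots> \<longleftrightarrow> a \<noteq> b \<and> \<bar>fst a - fst b\<bar> \<le> 1 \<and> \<bar>snd a - snd b\<bar> \<le> 1"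
    by (cases a) (auto simp: b)
  finally show ?thesis .
qed

text \<open>
  Connection by a \<open>*\<close>-walk that stays in \<open>S\<close>; repetitions are removed only when a crossing is
  extracted.
\<close>
definition star_connected :: "site set \<Rightarrow> site \<Rightarrow> site \<Rightarrow> bool" where
  "star_connected S a b \<longleftrightarrow> a \<in> S \<and> (a, b) \<in> {(u, v). star_neighbor u v \<and> u \<in> S \<and> v \<in> S}\<^sup>*"

lemma star_connected_refl: "a \<in> S \<Longrightarrow> star_connected S a a"
  by (simp add: star_connected_def)

lemma star_connected_step:
  "star_connected S a b \<Longrightarrow> star_neighbor b c \<Longrightarrow> b \<in> S \<Longrightarrow> c \<in> S \<Longrightarrow> star_connected S a c"
  unfolding star_connected_def by (auto intro: rtrancl_into_rtrancl)

lemma star_connected_trans: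
  "star_connected S a b \<Longrightarrow> star_connected S b c \<Longrightarrow> star_connected S a c"
  unfolding star_connected_def by auto

lemma star_connected_induct [consumes 1, case_names base step]:
  assumes "star_connected S a b" "a \<in> S \<Longrightarrow> P a"
    "\<And>u v. star_neighbor u v \<Longrightarrow> u \<in> S \<Longrightarrow> v \<in> S \<Longrightarrow> P u \<Longrightarrow> P v"
  shows "P b"
proof -
  have "a \<in> S" "(a, b) \<in> {(u, v). star_neighbor u v \<and> u \<in> S \<and> v \<in> S}\<^sup>*"
    using assms(1) by (auto simp: star_connected_def)
  from this(2) show ?thesis
  proof (induction rule: rtrancl_induct)
    case base
    show ?case using assms(2) \<open>a \<in> S\<close> by simp
  next
    case (step u v)
    then show ?case using assms(3)[of u v] by simp
  qed
qed

lemma star_connected_mono: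
  assumes "star_connected S a b" "S \<subseteq> S'"
  shows "star_connected S' a b"
  using assms(1)
proof (induction rule: star_connected_induct)
  case base
  then show ?case using assms(2) by (blast intro: star_connected_refl)
next
  case (step u v)
  then show ?case using assms(2) star_connected_step[of S' a u v] by blast
qed

text \<open>
  The open sites that account for \<open>a\<close> being open after the next step.
\<close>
definition witnesses :: "config \<Rightarrow> site \<Rightarrow> site set" where
  "witnesses \<omega> a = (if \<omega> a then {a} else {y. neighbor a y \<and> \<omega> y})"

lemma step_open_pair:
  assumes "bootstrap_step \<omega> a" "\<not> \<omega> a" "neighbor a u" "neighbor a v" "u \<noteq> v"
  shows "\<omega> u \<or> \<omega> v"
  using assms unfolding bootstrap_step_iff by blast

lemma witnesses_nonempty:
  assumes "bootstrap_step \<omega> a"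
  shows "witnesses \<omega> a \<noteq> {}"
proof (cases "\<omega> a")
  case True
  then show ?thesis by (simp add: witnesses_def)
next
  case False
  define u v where "u = (fst a + 1, snd a)" and "v = (fst a - 1, snd a)"
  have n: "neighbor a u" "neighbor a v" "u \<noteq> v" by (simp_all add: u_def v_def neighbor_iff)
  then have "u \<in> witnesses \<omega> a \<or> v \<in> witnesses \<omega> a"
    using step_open_pair[OF assms False n] False by (simp add: witnesses_def)
  then show ?thesis by blast
qed

lemma witnesses_near:
  "u \<in> witnesses \<omega> a \<Longrightarrow> \<omega> u \<and> \<bar>fst u - fst a\<bar> \<le> 1 \<and> \<bar>snd u - snd a\<bar> \<le> 1"
  by (auto simp: witnesses_def neighbor_iff split: if_splits)

text \<open>
  Two open neighbours of \<open>a\<close> on different axes are \<open>*\<close>-neighbours; two on the same axis are joined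
  through a neighbour on the other axis, at least one of which is open.
\<close>
lemma witnesses_connected:
  assumes "bootstrap_step \<omega> a" "u \<in> witnesses \<omega> a" "v \<in> witnesses \<omega> a" "witnesses \<omega> a \<subseteq> S"
  shows "star_connected S u v"
proof -
  have "u = v \<or> star_neighbor u v \<or> (\<exists>w\<in>witnesses \<omega> a. star_neighbor u w \<and> star_neighbor w v)"
  proof (cases "\<omega> a")
    case True then show ?thesis using assms by (simp add: witnesses_def)
  next
    case False
    obtain i j where a: "a = (i, j)" by fastforce
    define H where "H = {(i + 1, j), (i - 1, j)}"
    define V where "V = {(i, j + 1), (i, j - 1)}"
    note p = step_open_pair[OF assms(1) False]
    have "\<omega> (i, j + 1) \<or> \<omega> (i, j - 1)" "\<omega> (i + 1, j) \<or> \<omega> (i - 1, j)"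
      by (rule p; simp add: neighbor_iff a)+
    then obtain p q where pq: "p \<in> H" "p \<in> witnesses \<omega> a" "q \<in> V" "q \<in> witnesses \<omega> a"
      using False unfolding H_def V_def by (fastforce simp: witnesses_def neighbor_iff a)
    have HV: "star_neighbor c d \<and> star_neighbor d c" if "c \<in> H" "d \<in> V" for c d
      using that by (auto simp: H_def V_def star_neighbor_iff)
    have "u \<in> H \<union> V" "v \<in> H \<union> V"
      using assms(2,3) False by (auto simp: witnesses_def neighbor_iff a H_def V_def)
    then show ?thesis using pq HV by blast
  qed
  then consider "u = v" | "star_neighbor u v" | w where "w \<in> witnesses \<omega> a" "star_neighbor u w" "star_neighbor w v"
    by blast
  moreover have S: "u \<in> S" "v \<in> S" using assms by auto
  ultimately show ?thesis
  proof cases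
    case 1 then show ?thesis using S star_connected_refl by simp
  next
    case 2 then show ?thesis using S star_connected_refl star_connected_step by blast
  next
    case 3
    have "w \<in> S" using 3(1) assms(4) by blast
    have "star_connected S u w"
      using star_connected_step[OF star_connected_refl 3(2)] S \<open>w \<in> S\<close> by blast
    then show ?thesis using star_connected_step 3(3) S \<open>w \<in> S\<close> by blast
  qed
qed

text \<open>
  If \<open>a\<close> and \<open>b\<close> are diagonal neighbours, they have two common neighbours, and one of these is open
  as soon as \<open>a\<close> or \<open>b\<close> is newly opened. If they are lattice neighbours and both newly opened, each is
  the closed neighbour of the other, so the translates of both by a unit vector orthogonal to
  \<open>b - a\<close> are open.
\<close>
lemma witnesses_adjacent:
  assumes "star_neighbor a b" "bootstrap_step \<omega> a" "bootstrap_step \<omega> b"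
  shows "\<exists>u\<in>witnesses \<omega> a. \<exists>v\<in>witnesses \<omega> b. u = v \<or> star_neighbor u v"
proof -
  obtain i j where a: "a = (i, j)" by fastforce
  obtain k l where b: "b = (k, l)" by fastforce
  have kl: "k - i \<in> {-1, 0, 1}" "l - j \<in> {-1, 0, 1}" "k \<noteq> i \<or> l \<noteq> j"
    using assms(1) by (auto simp: star_neighbor_iff a b)
  show ?thesis
  proof (cases "k \<noteq> i \<and> l \<noteq> j")
    case diag: True
    then have c: "k = i + 1 \<or> k = i - 1" "l = j + 1 \<or> l = j - 1" using kl by auto
    have nb: "neighbor a (k, j)" "neighbor a (i, l)" "neighbor b (k, j)" "neighbor b (i, l)"
      using c by (auto simp: neighbor_iff a b)
    have st: "star_neighbor a (k, j)" "star_neighbor a (i, l)" "star_neighbor (k, j) b" "star_neighbor (i, l) b"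
      using c by (auto simp: star_neighbor_iff a b)
    have ne: "(k, j) \<noteq> (i, l)" using diag by simp
    consider "\<omega> a" "\<omega> b" | "\<not> \<omega> a \<or> \<not> \<omega> b" "\<omega> (k, j) \<or> \<omega> (i, l)"
      using step_open_pair[OF assms(2) _ nb(1,2) ne] step_open_pair[OF assms(3) _ nb(3,4) ne] by blast
    then show ?thesis
    proof cases
      case 1 then show ?thesis using assms(1) by (simp add: witnesses_def)
    next
      case 2
      then obtain w where w: "w = (k, j) \<or> w = (i, l)" "\<omega> w" by blast
      then have "neighbor a w" "neighbor b w" "star_neighbor a w" "star_neighbor w b" using nb st by auto
      then show ?thesis using 2(1) w by (cases "\<omega> a"; cases "\<omega> b") (auto simp: witnesses_def)
    qed
  next
    case False
    then have nab: "neighbor a b" "neighbor b a" using kl by (auto simp: neighbor_iff a b)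
    show ?thesis
    proof (cases "\<omega> a \<or> \<omega> b")
      case True
      then show ?thesis using nab assms(1)
        by (cases "\<omega> a"; cases "\<omega> b") (auto simp: witnesses_def simp del: split_paired_Ex)
    next
      case cl: False
      \<comment> \<open>\<open>(s, 1 - s)\<close> is the unit vector orthogonal to \<open>b - a\<close>.\<close>
      define s where "s = (if k = i then 1 else (0::int))"
      define u where "u = (i + s, j + 1 - s)"
      define v where "v = (k + s, l + 1 - s)"
      have "neighbor a u" "neighbor b v" "u \<noteq> b" "v \<noteq> a" "star_neighbor u v"
        using False kl by (auto simp: neighbor_iff star_neighbor_iff a b u_def v_def s_def)
      moreover from this have "\<omega> u" "\<omega> v"
        using cl nab step_open_pair[OF assms(2), of b u] step_open_pair[OF assms(3), of a v] by auto
      ultimately have "u \<in> witnesses \<omega> a" "v \<in> witnesses \<omega> b" "star_neighbor u v"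
        using cl by (auto simp: witnesses_def)
      then show ?thesis by blast
    qed
  qed
qed

text \<open>
  Only the horizontal extent of the walk is recorded; the vertical one is restored by cutting the
  walk at the two levels of the target rectangle.
\<close>
lemma star_connected_step_back:
  assumes "star_connected {y. bootstrap_step \<omega> y \<and> \<bar>real_of_int (fst y)\<bar> \<le> W} a b"
    and "a' \<in> witnesses \<omega> a" "b' \<in> witnesses \<omega> b"
  shows "star_connected {y. \<omega> y \<and> \<bar>real_of_int (fst y)\<bar> \<le> W + 1} a' b'"
proof -
  let ?S' = "{y. \<omega> y \<and> \<bar>real_of_int (fst y)\<bar> \<le> W + 1}"
  have sub: "witnesses \<omega> y \<subseteq> ?S'" if "\<bar>real_of_int (fst y)\<bar> \<le> W" for y
  proof
    fix u assume u: "u \<in> witnesses \<omega> y"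
    have "\<bar>fst u\<bar> \<le> \<bar>fst y\<bar> + 1" using witnesses_near[OF u] by linarith
    then have "\<bar>real_of_int (fst u)\<bar> \<le> \<bar>real_of_int (fst y)\<bar> + 1" by linarith
    then show "u \<in> ?S'" using witnesses_near[OF u] that by simp
  qed
  from assms(1) have "\<forall>b'\<in>witnesses \<omega> b. star_connected ?S' a' b'"
  proof (induction rule: star_connected_induct)
    case base
    then show ?case using witnesses_connected[OF _ assms(2)] sub by blast
  next
    case (step u v)
    obtain u' v' where uv: "u' \<in> witnesses \<omega> u" "v' \<in> witnesses \<omega> v" "u' = v' \<or> star_neighbor u' v'"
      using witnesses_adjacent[of u v \<omega>] step by blast
    have "u' \<in> ?S'" "v' \<in> ?S'" using uv sub step by blast+
    then have "star_connected ?S' a' v'"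
      using step.IH uv star_connected_step by blast
    moreover have "star_connected ?S' v' w" if "w \<in> witnesses \<omega> v" for w
      using witnesses_connected[of \<omega> v v' w ?S'] uv(2) that sub step by blast
    ultimately show ?case using star_connected_trans by blast
  qed
  with assms(3) show ?thesis by blast
qed

lemma star_connected_bootstrap:
  assumes "star_connected {y. bootstrap n \<omega> y \<and> \<bar>real_of_int (fst y)\<bar> \<le> W} a b"
  shows "\<exists>a' b'. star_connected {y. \<omega> y \<and> \<bar>real_of_int (fst y)\<bar> \<le> W + n} a' b'
           \<and> \<bar>snd a' - snd a\<bar> \<le> int n \<and> \<bar>snd b' - snd b\<bar> \<le> int n"
  using assms
proof (induction n arbitrary: W a b)
  case 0
  then show ?case by (intro exI[of _ a] exI[of _ b]) simp
next
  case (Suc n)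
  let ?S = "{y. bootstrap (Suc n) \<omega> y \<and> \<bar>real_of_int (fst y)\<bar> \<le> W}"
  have "a \<in> ?S" using Suc.prems by (simp only: star_connected_def)
  moreover have "b \<in> ?S" using Suc.prems by (induction rule: star_connected_induct) auto
  ultimately have ab: "bootstrap_step (bootstrap n \<omega>) a" "bootstrap_step (bootstrap n \<omega>) b"
    by (simp_all add: bootstrap_Suc)
  obtain a1 b1 where 1: "a1 \<in> witnesses (bootstrap n \<omega>) a" "b1 \<in> witnesses (bootstrap n \<omega>) b"
    using witnesses_nonempty[OF ab(1)] witnesses_nonempty[OF ab(2)] by blast
  have "star_connected {y. bootstrap n \<omega> y \<and> \<bar>real_of_int (fst y)\<bar> \<le> W + 1} a1 b1"
    using star_connected_step_back[OF Suc.prems[unfolded bootstrap_Suc] 1] .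
  from Suc.IH[OF this] obtain a' b' where
    "star_connected {y. \<omega> y \<and> \<bar>real_of_int (fst y)\<bar> \<le> W + 1 + n} a' b'"
    "\<bar>snd a' - snd a1\<bar> \<le> int n" "\<bar>snd b' - snd b1\<bar> \<le> int n" by blast
  moreover have "\<bar>snd a1 - snd a\<bar> \<le> 1" "\<bar>snd b1 - snd b\<bar> \<le> 1"
    using witnesses_near 1 by blast+
  ultimately show ?case
    by (intro exI[of _ a'] exI[of _ b']) (auto simp: algebra_simps)
qed

lemma successively_star_connected:
  assumes "xs \<noteq> []" "successively star_neighbor xs" "set xs \<subseteq> S"
  shows "star_connected S (hd xs) (last xs)"
  using assms
proof (induction xs rule: rev_nonempty_induct)
  case (single x) then show ?case by (simp add: star_connected_refl)
next
  case (snoc x xs)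
  then have "star_connected S (hd xs) (last xs)" "star_neighbor (last xs) x" "last xs \<in> S" "x \<in> S"
    by (auto simp: successively_append_iff)
  then show ?case using snoc.hyps star_connected_step by simp
qed

lemma star_connected_walk:
  assumes "star_connected S a b"
  shows "\<exists>xs. xs \<noteq> [] \<and> successively star_neighbor xs \<and> set xs \<subseteq> S \<and> hd xs = a \<and> last xs = b"
  using assms
proof (induction rule: star_connected_induct)
  case base
  then show ?case by (intro exI[of _ "[a]"]) auto
next
  case (step u v)
  then obtain xs where "xs \<noteq> []" "successively star_neighbor xs" "set xs \<subseteq> S" "hd xs = a" "last xs = u"
    by blast
  with step show ?case by (intro exI[of _ "xs @ [v]"]) (auto simp: successively_append_iff)
qed

lemma closed_segment_snd_bounds:
  fixes p q t :: "real \<times> real"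
  assumes "t \<in> closed_segment p q"
  shows "min (snd p) (snd q) \<le> snd t" "snd t \<le> max (snd p) (snd q)"
proof -
  obtain u where u: "0 \<le> u" "u \<le> 1" "t = (1 - u) *\<^sub>R p + u *\<^sub>R q"
    using assms by (auto simp: in_segment)
  have t: "snd t = (1 - u) * snd p + u * snd q" by (simp add: u)
  have "(1 - u) * snd p + u * snd q \<le> max (snd p) (snd q)"
    using u by (intro convex_bound_le) auto
  moreover have "(1 - u) * (- snd p) + u * (- snd q) \<le> - min (snd p) (snd q)"
    using u by (intro convex_bound_le) auto
  ultimately show "min (snd p) (snd q) \<le> snd t" "snd t \<le> max (snd p) (snd q)"
    unfolding t by (simp_all add: algebra_simps)
qed

lemma closed_segment_meets_level:
  fixes p q :: "real \<times> real"
  assumes "snd q \<le> c" "c \<le> snd p" "\<bar>fst p\<bar> \<le> w" "\<bar>fst q\<bar> \<le> w"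
  shows "closed_segment p q \<inter> ({-w..w} \<times> {c}) \<noteq> {}"
proof -
  have "c \<in> closed_segment (snd p) (snd q)"
    using assms(1,2) by (simp add: closed_segment_eq_real_ivl)
  then obtain u where u: "0 \<le> u" "u \<le> 1" "c = (1 - u) *\<^sub>R snd p + u *\<^sub>R snd q"
    unfolding in_segment by blast
  define t where "t = (1 - u) *\<^sub>R p + u *\<^sub>R q"
  have f: "fst t = (1 - u) * fst p + u * fst q" "snd t = c"
    unfolding t_def u(3) by (rule fst_add[THEN trans], simp only: fst_scaleR real_scaleR_def) (simp only: snd_add snd_scaleR)
  have "fst p \<le> w" "fst q \<le> w" "- fst p \<le> w" "- fst q \<le> w" using assms(3,4) by linarith+
  note b = this
  have "fst t \<le> w" unfolding f(1) by (rule convex_bound_le) (use b u in auto)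
  moreover have "(1 - u) * (- fst p) + u * (- fst q) \<le> w" by (rule convex_bound_le) (use b u in auto)
  then have "- w \<le> fst t" unfolding f(1) by (simp only: mult_minus_right)
  ultimately have "t \<in> {-w..w} \<times> {c}"
    using f(2) by (cases t) simp
  moreover have "t \<in> closed_segment p q" unfolding in_segment t_def
    by (intro exI[of _ u] conjI u(1,2) refl)
  ultimately show ?thesis by blast
qed

text \<open>
  Only the two end sites of a crossing may lie outside the rectangle, and they are \<open>*\<close>-neighbours of
  sites inside it; hence the slack of \<open>1\<close>.
\<close>
lemma crossing_star_connected:
  assumes "vertical_star_crossing \<delta> b h \<eta>" "\<delta> > 0"
  shows "\<exists>x y. star_connected {s. \<eta> s \<and> \<bar>real_of_int (fst s)\<bar> \<le> b / (2 * \<delta>) + 1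
                 \<and> \<bar>real_of_int (snd s)\<bar> \<le> h / (2 * \<delta>) + 1} x y
           \<and> h / 2 \<le> \<delta> * real_of_int (snd x) \<and> \<delta> * real_of_int (snd y) \<le> - h / 2"
proof -
  obtain m xs where m: "1 \<le> m" "length xs = m + 2"
    and path: "site_path star_neighbor xs"
    and op: "\<forall>j\<in>{0..m+1}. \<eta> (xs ! j)"
    and inr: "\<forall>j\<in>{1..m}. \<delta> *\<^sub>R pt (xs ! j) \<in> rect b h"
    and top: "closed_segment (\<delta> *\<^sub>R pt (xs ! 0)) (\<delta> *\<^sub>R pt (xs ! 1)) \<inter> top_side b h \<noteq> {}"
    and bot: "closed_segment (\<delta> *\<^sub>R pt (xs ! m)) (\<delta> *\<^sub>R pt (xs ! (m+1))) \<inter> bottom_side b h \<noteq> {}"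
    using assms(1) unfolding vertical_star_crossing_def by blast
  let ?S = "{s. \<eta> s \<and> \<bar>real_of_int (fst s)\<bar> \<le> b / (2 * \<delta>) + 1
                 \<and> \<bar>real_of_int (snd s)\<bar> \<le> h / (2 * \<delta>) + 1}"
  have suc: "successively star_neighbor xs" using path by (simp add: site_path_def)
  have inj: "\<bar>real_of_int (fst (xs ! j))\<bar> \<le> b / (2 * \<delta>)" "\<bar>real_of_int (snd (xs ! j))\<bar> \<le> h / (2 * \<delta>)"
    "\<bar>\<delta> * real_of_int (snd (xs ! j))\<bar> < h / 2"
    if "1 \<le> j" "j \<le> m" for j
  proof -
    have "\<delta> *\<^sub>R pt (xs ! j) \<in> rect b h" using inr that by simp
    then have 1: "\<bar>\<delta> * real_of_int (fst (xs ! j))\<bar> < b / 2" and 2: "\<bar>\<delta> * real_of_int (snd (xs ! j))\<bar> < h / 2"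
      by (auto simp: rect_def pt_def)
    from 2 show "\<bar>\<delta> * real_of_int (snd (xs ! j))\<bar> < h / 2" .
    have "\<delta> * \<bar>real_of_int (fst (xs ! j))\<bar> < b / 2" "\<delta> * \<bar>real_of_int (snd (xs ! j))\<bar> < h / 2"
      using 1 2 assms(2) by (simp_all add: abs_mult)
    then show "\<bar>real_of_int (fst (xs ! j))\<bar> \<le> b / (2 * \<delta>)" "\<bar>real_of_int (snd (xs ! j))\<bar> \<le> h / (2 * \<delta>)"
      using assms(2) by (simp_all add: field_simps)
  qed
  have adj: "star_neighbor (xs ! j) (xs ! Suc j)" if "j \<le> m" for j
    using suc that m by (simp add: successively_conv_nth)
  have bd: "\<bar>real_of_int (fst (xs ! j))\<bar> \<le> b / (2 * \<delta>) + 1 \<and> \<bar>real_of_int (snd (xs ! j))\<bar> \<le> h / (2 * \<delta>) + 1"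
    if jm: "j \<le> m + 1" for j
  proof -
    obtain i where i: "1 \<le> i" "i \<le> m" and near: "\<bar>fst (xs ! j) - fst (xs ! i)\<bar> \<le> 1" "\<bar>snd (xs ! j) - snd (xs ! i)\<bar> \<le> 1"
    proof -
      consider "j = 0" | "1 \<le> j" "j \<le> m" | "j = Suc m" using jm by linarith
      then show ?thesis
      proof cases
        case 1 then show ?thesis using that[of 1] m adj[of 0] by (auto simp: star_neighbor_iff)
      next
        case 2 then show ?thesis using that[of j] by simp
      next
        case 3 then show ?thesis using that[of m] m adj[of m] by (auto simp: star_neighbor_iff)
      qed
    qed
    have "\<bar>real_of_int (fst (xs ! j)) - fst (xs ! i)\<bar> \<le> 1" "\<bar>real_of_int (snd (xs ! j)) - snd (xs ! i)\<bar> \<le> 1"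
      using near by linarith+
    then show ?thesis using inj(1,2)[OF i] by linarith
  qed
  have "set xs \<subseteq> ?S"
  proof
    fix s assume "s \<in> set xs"
    then obtain j where "j < length xs" "xs ! j = s" by (auto simp: in_set_conv_nth)
    then show "s \<in> ?S" using op bd[of j] m by auto
  qed
  then have "star_connected ?S (hd xs) (last xs)"
    using m suc by (intro successively_star_connected) auto
  moreover have "hd xs = xs ! 0" using m by (intro hd_conv_nth) auto
  moreover have "last xs = xs ! (m + 1)" using m by (subst last_conv_nth) auto
  moreover have "h / 2 \<le> \<delta> * real_of_int (snd (xs ! 0))"
  proof -
    obtain t where t: "t \<in> closed_segment (\<delta> *\<^sub>R pt (xs ! 0)) (\<delta> *\<^sub>R pt (xs ! 1))"
        "t \<in> top_side b h"
      using top by blast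
    have "snd t = h / 2" using t(2) by (simp add: top_side_def mem_Times_iff)
    moreover have "snd t \<le> max (\<delta> * real_of_int (snd (xs ! 0))) (\<delta> * real_of_int (snd (xs ! 1)))"
      using closed_segment_snd_bounds(2)[OF t(1)] by (simp add: pt_def)
    moreover have "\<delta> * real_of_int (snd (xs ! 1)) < h / 2" using inj(3)[of 1] m by linarith
    ultimately show ?thesis by linarith
  qed
  moreover have "\<delta> * real_of_int (snd (xs ! (m + 1))) \<le> - h / 2"
  proof -
    obtain t where t: "t \<in> closed_segment (\<delta> *\<^sub>R pt (xs ! m)) (\<delta> *\<^sub>R pt (xs ! (m+1)))"
        "t \<in> bottom_side b h"
      using bot by blast
    have "snd t = - h / 2" using t(2) by (simp add: bottom_side_def mem_Times_iff)
    moreover have "min (\<delta> * real_of_int (snd (xs ! m))) (\<delta> * real_of_int (snd (xs ! (m+1)))) \<le> snd t"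
      using closed_segment_snd_bounds(1)[OF t(1)] by (simp add: pt_def)
    moreover have "- h / 2 < \<delta> * real_of_int (snd (xs ! m))" using inj(3)[of m] m by linarith
    ultimately show ?thesis by linarith
  qed
  ultimately show ?thesis by (intro exI[of _ "xs ! 0"] exI[of _ "xs ! (m + 1)"]) simp
qed

text \<open>
  A shortest walk from above the top side to below the bottom side is a crossing: it has no
  repetitions, and only its ends lie outside the strip between the two sides, for otherwise it
  could be shortened. The condition \<open>\<delta> < h\<close> prevents it from jumping over the strip.
\<close>
lemma star_connected_crossing:
  assumes con: "star_connected {s. \<eta> s \<and> \<bar>real_of_int (fst s)\<bar> \<le> W} x y"
    and xy: "h / 2 \<le> \<delta> * real_of_int (snd x)" "\<delta> * real_of_int (snd y) \<le> - h / 2"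
    and d: "\<delta> > 0" "\<delta> < h" "\<delta> * W < b / 2"
  shows "vertical_star_crossing \<delta> b h \<eta>"
proof -
  let ?S = "{s. \<eta> s \<and> \<bar>real_of_int (fst s)\<bar> \<le> W}"
  define hi where "hi = (\<lambda>s::site. h / 2 \<le> \<delta> * real_of_int (snd s))"
  define lo where "lo = (\<lambda>s::site. \<delta> * real_of_int (snd s) \<le> - h / 2)"
  define walk where "walk = (\<lambda>xs. xs \<noteq> [] \<and> successively star_neighbor xs \<and> set xs \<subseteq> ?S
      \<and> hi (hd xs) \<and> lo (last xs))"
  obtain xs0 where "xs0 \<noteq> []" "successively star_neighbor xs0" "set xs0 \<subseteq> ?S"
      "hd xs0 = x" "last xs0 = y"
    using star_connected_walk[OF con] by blast
  then have "walk xs0" using xy by (simp add: walk_def hi_def lo_def)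
  then obtain xs where xs: "walk xs" and min: "\<And>ys. walk ys \<Longrightarrow> length xs \<le> length ys"
    using ex_has_least_nat[of walk xs0 length] by blast
  have ne: "xs \<noteq> []" and suc: "successively star_neighbor xs" and sub: "set xs \<subseteq> ?S"
    and hi: "hi (xs ! 0)" and lo: "lo (xs ! (length xs - 1))"
    using xs by (auto simp: walk_def hd_conv_nth last_conv_nth)
  have hilo: "\<not> (hi s \<and> lo s)" for s using d by (auto simp: hi_def lo_def)
  have nothi: "\<not> hi (xs ! j)" if "0 < j" "j < length xs" for j
  proof
    assume "hi (xs ! j)"
    moreover have "successively star_neighbor (drop j xs)"
      using suc by (auto simp: successively_conv_nth)
    moreover have "hd (drop j xs) = xs ! j" "last (drop j xs) = last xs" "drop j xs \<noteq> []"
      using that by (simp_all add: hd_drop_conv_nth)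
    moreover have "set (drop j xs) \<subseteq> ?S" using sub set_drop_subset by (rule subset_trans[rotated])
    ultimately have "walk (drop j xs)" using xs unfolding walk_def by simp
    from min[OF this] show False using that by simp
  qed
  have notlo: "\<not> lo (xs ! j)" if "Suc j < length xs" for j
  proof
    assume "lo (xs ! j)"
    moreover have "successively star_neighbor (take (Suc j) xs)"
      using suc by (auto simp: successively_conv_nth)
    moreover have "last (take (Suc j) xs) = xs ! j"
      using that by (simp add: take_Suc_conv_app_nth)
    moreover have "hd (take (Suc j) xs) = hd xs" "take (Suc j) xs \<noteq> []"
      using ne by simp_all
    moreover have "set (take (Suc j) xs) \<subseteq> ?S" using sub set_take_subset by (rule subset_trans[rotated])
    ultimately have "walk (take (Suc j) xs)" using xs unfolding walk_def by simp
    from min[OF this] show False using that by simp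
  qed
  have dist: "xs ! i \<noteq> xs ! j" if ij: "i < j" "j < length xs" for i j
  proof
    assume eq: "xs ! i = xs ! j"
    have "0 < i" using nothi[of j] hi ij eq by (cases i) auto
    have "Suc j < length xs"
    proof (rule ccontr)
      assume "\<not> ?thesis"
      then have "j = length xs - 1" using ij by simp
      then show False using lo notlo[of i] ij eq by auto
    qed
    let ?ys = "take (Suc i) xs @ drop (Suc j) xs"
    have "successively star_neighbor (take (Suc i) xs)" "successively star_neighbor (drop (Suc j) xs)"
      using suc by (auto simp: successively_conv_nth)
    moreover have "last (take (Suc i) xs) = xs ! j"
      using ij eq by (simp add: take_Suc_conv_app_nth)
    moreover have "hd (drop (Suc j) xs) = xs ! Suc j"
      using \<open>Suc j < length xs\<close> by (simp add: hd_drop_conv_nth)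
    moreover have "star_neighbor (xs ! j) (xs ! Suc j)"
      using suc \<open>Suc j < length xs\<close> by (simp add: successively_conv_nth)
    ultimately have "successively star_neighbor ?ys"
      by (simp only: successively_append_iff) simp
    moreover have "set ?ys \<subseteq> ?S"
      using subset_trans[OF set_take_subset sub] subset_trans[OF set_drop_subset sub] by simp
    moreover have "hd ?ys = hd xs" "last ?ys = last xs"
      using ne \<open>Suc j < length xs\<close> by (simp_all add: hd_append last_append)
    ultimately have "walk ?ys" using xs ne by (simp add: walk_def)
    from min[OF this] show False using ij \<open>Suc j < length xs\<close> by simp
  qed
  have distinct: "distinct xs"
    unfolding distinct_conv_nth using dist by (metis linorder_neqE_nat)
  have len: "3 \<le> length xs"
  proof (rule ccontr)
    assume "\<not> 3 \<le> length xs"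
    moreover have "length xs \<noteq> 0" using ne by simp
    ultimately have "length xs = 1 \<or> length xs = 2" by linarith
    then show False
    proof
      assume "length xs = 1"
      then show False using hi lo hilo by auto
    next
      assume l: "length xs = 2"
      then have "star_neighbor (xs ! 0) (xs ! 1)" using suc by (simp add: successively_conv_nth)
      then have "snd (xs ! 0) \<le> snd (xs ! 1) + 1" by (auto simp: star_neighbor_iff)
      then have "real_of_int (snd (xs ! 0)) \<le> snd (xs ! 1) + 1" by linarith
      then have "\<delta> * real_of_int (snd (xs ! 0)) \<le> \<delta> * (snd (xs ! 1) + 1)" using d by simp
      then show False using hi lo d l by (auto simp: hi_def lo_def algebra_simps)
    qed
  qed
  define m where "m = length xs - 2"
  have lm: "length xs = m + 2" "1 \<le> m" using len by (auto simp: m_def)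
  have fb: "\<bar>\<delta> * real_of_int (fst (xs ! j))\<bar> < b / 2" if "j < length xs" for j
  proof -
    have "xs ! j \<in> ?S" using sub nth_mem[OF that] by (rule subsetD)
    then have "\<delta> * \<bar>real_of_int (fst (xs ! j))\<bar> \<le> \<delta> * W" using d by simp
    moreover have "\<bar>\<delta> * real_of_int (fst (xs ! j))\<bar> = \<delta> * \<bar>real_of_int (fst (xs ! j))\<bar>"
      using d by (simp add: abs_mult)
    ultimately show ?thesis using d by linarith
  qed
  have sb: "\<bar>\<delta> * real_of_int (snd (xs ! j))\<bar> < h / 2" if "1 \<le> j" "j \<le> m" for j
    using nothi[of j] notlo[of j] that lm by (auto simp: hi_def lo_def)
  have inr: "\<forall>j\<in>{1..m}. \<delta> *\<^sub>R pt (xs ! j) \<in> rect b h"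
  proof
    fix j assume "j \<in> {1..m}"
    then show "\<delta> *\<^sub>R pt (xs ! j) \<in> rect b h"
      using fb[of j] sb[of j] lm by (auto simp: rect_def pt_def)
  qed
  have "closed_segment (\<delta> *\<^sub>R pt (xs ! 0)) (\<delta> *\<^sub>R pt (xs ! 1)) \<inter> ({-(b/2)..b/2} \<times> {h/2}) \<noteq> {}"
    using fb[of 0] fb[of 1] sb[of 1] hi lm
    by (intro closed_segment_meets_level) (auto simp: pt_def hi_def)
  moreover have "closed_segment (\<delta> *\<^sub>R pt (xs ! m)) (\<delta> *\<^sub>R pt (xs ! (m+1))) \<inter> ({-(b/2)..b/2} \<times> {-h/2}) \<noteq> {}"
    using fb[of m] fb[of "m+1"] sb[of m] lo lm
    by (intro closed_segment_meets_level) (auto simp: pt_def lo_def)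
  moreover have "\<forall>j\<in>{0..m+1}. \<eta> (xs ! j)"
  proof
    fix j assume "j \<in> {0..m + 1}"
    then have "xs ! j \<in> set xs" using lm by (intro nth_mem) simp
    then show "\<eta> (xs ! j)" using sub by blast
  qed
  ultimately show ?thesis
    unfolding vertical_star_crossing_def site_path_def top_side_def bottom_side_def
    using inr lm ne distinct suc by (intro exI[of _ m] exI[of _ xs]) simp
qed

section \<open>Crossing probabilities\<close>

text \<open>
  There are only countably many candidate paths, since a path is a finite list of sites.
\<close>
lemma measurable_crossing:
  assumes [measurable]: "\<And>x. Measurable.pred M (\<lambda>\<omega>. f \<omega> x)"
  shows "Measurable.pred M (\<lambda>\<omega>. vertical_star_crossing \<delta> b h (f \<omega>))"
  unfolding vertical_star_crossing_def by measurable

lemma crossing_sets: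
  "{\<omega>. vertical_star_crossing \<delta> b h \<omega>} \<in> sets (bernoulli_config p)"
  "{\<omega>. vertical_star_crossing \<delta> b h (bootstrap_limit \<omega>)} \<in> sets (bernoulli_config p)"
proof -
  have "Measurable.pred (bernoulli_config p) (\<lambda>\<omega>. bootstrap_limit \<omega> x)" for x
    unfolding bootstrap_limit_iff by measurable
  then show "{\<omega>. vertical_star_crossing \<delta> b h (bootstrap_limit \<omega>)} \<in> sets (bernoulli_config p)"
    using measurable_crossing[of bootstrap_limit "bernoulli_config p"] by (simp add: pred_def)
  show "{\<omega>. vertical_star_crossing \<delta> b h \<omega>} \<in> sets (bernoulli_config p)"
    using measurable_crossing[of "\<lambda>\<omega>. \<omega>" "bernoulli_config p", OF measurable_site] by (simp add: pred_def)
qed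

text \<open>
  Initially open sites stay open, so an initial crossing is a final crossing by the same path.
\<close>
lemma crossing_prob_le_limit: "crossing_prob p \<delta> b h 0 \<le> crossing_prob_limit p \<delta> b h"
proof -
  interpret prob_space "bernoulli_config p" by (rule prob_space_bernoulli_config)
  have mono: "\<omega> x \<Longrightarrow> bootstrap_limit \<omega> x" for \<omega> x
    unfolding bootstrap_limit_iff by (rule exI[of _ 0]) simp
  have "vertical_star_crossing \<delta> b h (bootstrap_limit \<omega>)" if "vertical_star_crossing \<delta> b h \<omega>" for \<omega>
    using that mono unfolding vertical_star_crossing_def by blast
  then show ?thesis
    unfolding crossing_prob_def crossing_prob_limit_def
    using crossing_sets(2) by (intro finite_measure_mono) auto
qed

text \<open>
  Without late openings in the box, the sites of a final crossing are already open at time \<open>n\<close>.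
  Undoing these \<open>n\<close> steps displaces the crossing by at most \<open>n\<close> units, which the larger width and the
  smaller height of the new rectangle absorb.
\<close>
lemma limit_crossing_initial_crossing:
  fixes K n :: nat
  assumes cr: "vertical_star_crossing \<delta> b h (bootstrap_limit \<omega>)"
    and nl: "\<omega> \<notin> late_flip K n"
    and d: "0 < \<delta>" "\<delta> < h'" and K: "b / (2 * \<delta>) + 1 \<le> K" "h / (2 * \<delta>) + 1 \<le> K"
    and b': "b / 2 + \<delta> * (real n + 1) < b' / 2" and h': "h' / 2 \<le> h / 2 - \<delta> * real n"
  shows "vertical_star_crossing \<delta> b' h' \<omega>"
proof -
  let ?W = "b / (2 * \<delta>) + 1"
  obtain x y where con: "star_connected {s. bootstrap_limit \<omega> s \<and> \<bar>real_of_int (fst s)\<bar> \<le> ?W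
                 \<and> \<bar>real_of_int (snd s)\<bar> \<le> h / (2 * \<delta>) + 1} x y"
    and xy: "h / 2 \<le> \<delta> * real_of_int (snd x)" "\<delta> * real_of_int (snd y) \<le> - h / 2"
    using crossing_star_connected[OF cr d(1)] by blast
  have "bootstrap n \<omega> s" if lim: "bootstrap_limit \<omega> s" and bd: "\<bar>real_of_int (fst s)\<bar> \<le> ?W"
    "\<bar>real_of_int (snd s)\<bar> \<le> h / (2 * \<delta>) + 1" for s
  proof (rule ccontr)
    assume nb: "\<not> bootstrap n \<omega> s"
    obtain N where N: "bootstrap N \<omega> s" using lim unfolding bootstrap_limit_iff by blast
    obtain k where "n \<le> k" "flips \<omega> k s" using flips_if_open_later[OF nb N] by blast
    moreover have "s \<in> {-int K..int K} \<times> {-int K..int K}"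
    proof -
      have "\<bar>real_of_int (fst s)\<bar> \<le> real K" "\<bar>real_of_int (snd s)\<bar> \<le> real K"
        using bd K by linarith+
      then have "\<bar>fst s\<bar> \<le> int K" "\<bar>snd s\<bar> \<le> int K" by linarith+
      then show ?thesis unfolding mem_Times_iff atLeastAtMost_iff by linarith
    qed
    ultimately show False using nl unfolding late_flip_def by blast
  qed
  then have "star_connected {s. bootstrap n \<omega> s \<and> \<bar>real_of_int (fst s)\<bar> \<le> ?W} x y"
    by (intro star_connected_mono[OF con]) blast
  from star_connected_bootstrap[OF this] obtain x' y' where
    con': "star_connected {s. \<omega> s \<and> \<bar>real_of_int (fst s)\<bar> \<le> ?W + n} x' y'"
    and near: "\<bar>snd x' - snd x\<bar> \<le> int n" "\<bar>snd y' - snd y\<bar> \<le> int n" by blast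
  have "real_of_int (snd x) - n \<le> real_of_int (snd x')" "real_of_int (snd y') \<le> real_of_int (snd y) + n"
    using near by linarith+
  then have "\<delta> * (real_of_int (snd x) - n) \<le> \<delta> * real_of_int (snd x')"
    "\<delta> * real_of_int (snd y') \<le> \<delta> * (real_of_int (snd y) + n)"
    using d by simp_all
  then have "h' / 2 \<le> \<delta> * real_of_int (snd x')" "\<delta> * real_of_int (snd y') \<le> - h' / 2"
    using xy h' by (simp_all add: algebra_simps)
  moreover have "\<delta> * (?W + n) < b' / 2"
  proof -
    have "\<delta> * (?W + n) = b / 2 + \<delta> * (real n + 1)" using d by (simp add: field_simps)
    with b' show ?thesis by simp
  qed
  ultimately show ?thesis using star_connected_crossing[OF con' _ _ d] by blast
qed

text \<open>
  The number of sites in the box grows like \<open>\<delta>\<^sup>-\<^sup>2\<close>, while each opens after time \<open>\<epsilon> / \<delta>\<close> with a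
  probability exponentially small in \<open>1 / \<delta>\<close>.
\<close>
lemma late_flip_prob_tendsto:
  fixes b h \<epsilon> :: real
  assumes "0 < b" "0 < h" "0 < \<epsilon>"
  shows "((\<lambda>\<delta>. measure (bernoulli_config p) (late_flip (nat \<lceil>(b + h) / \<delta>\<rceil> + 1) (nat \<lfloor>\<epsilon> / \<delta>\<rfloor>)))
           \<longlongrightarrow> 0) (at_right 0)"
proof -
  let ?M = "bernoulli_config p"
  obtain C \<rho> where C\<rho>: "0 < \<rho>" "\<rho> < 1" "0 \<le> C"
    "\<And>k x. measure ?M {\<omega>. flips \<omega> k x} \<le> C * \<rho> ^ k"
    by (rule prob_flips_exponential[of p]) (rule that)
  define c where "c = - ln \<rho>"
  have c: "0 < c" using C\<rho> by (simp add: c_def)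
  let ?g = "\<lambda>\<delta>::real. (2 * ((b + h) / \<delta> + 2) + 1)\<^sup>2 * (C * exp (- c * (\<epsilon> / \<delta> - 1)) / (1 - \<rho>))"
  have lim: "(?g \<longlongrightarrow> 0) (at_right 0)"
    using assms c C\<rho> by real_asymp
  have "\<forall>\<^sub>F \<delta> in at_right 0. measure ?M (late_flip (nat \<lceil>(b + h) / \<delta>\<rceil> + 1) (nat \<lfloor>\<epsilon> / \<delta>\<rfloor>)) \<le> ?g \<delta>"
    using eventually_at_right_less[of 0]
  proof eventually_elim
    case (elim \<delta>)
    define K where "K = nat \<lceil>(b + h) / \<delta>\<rceil> + 1"
    define n where "n = nat \<lfloor>\<epsilon> / \<delta>\<rfloor>"
    have "0 \<le> (b + h) / \<delta>" "0 \<le> \<epsilon> / \<delta>" using elim assms by auto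
    then have K_le: "real K \<le> (b + h) / \<delta> + 2" and n_ge: "\<epsilon> / \<delta> - 1 \<le> real n" unfolding K_def n_def by linarith+
    have "\<rho> ^ n = exp (- c * real n)"
      using C\<rho> by (simp add: c_def exp_of_nat_mult mult.commute flip: powr_realpow)
    also have "\<dots> \<le> exp (- c * (\<epsilon> / \<delta> - 1))" using n_ge c by simp
    finally have \<rho>n: "\<rho> ^ n \<le> exp (- c * (\<epsilon> / \<delta> - 1))" .
    have "measure ?M (late_flip K n) \<le> (2 * real K + 1)\<^sup>2 * (C * \<rho> ^ n / (1 - \<rho>))"
      by (rule late_flip_prob(2)[OF C\<rho>])
    also have "\<dots> \<le> ?g \<delta>"
    proof (rule mult_mono)
      show "(2 * real K + 1)\<^sup>2 \<le> (2 * ((b + h) / \<delta> + 2) + 1)\<^sup>2"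
        by (intro power_mono add_mono mult_left_mono K_le) auto
      show "C * \<rho> ^ n / (1 - \<rho>) \<le> C * exp (- c * (\<epsilon> / \<delta> - 1)) / (1 - \<rho>)"
        using \<rho>n C\<rho>(1-3) by (intro divide_right_mono mult_left_mono) auto
    qed (use C\<rho>(1-3) in auto)
    finally show ?case unfolding K_def n_def .
  qed
  then show ?thesis
    by (intro tendsto_sandwich[OF _ _ tendsto_const lim]) auto
qed

theorem theorem3:
  fixes F :: "real \<Rightarrow> real"
  assumes "continuous_on {0<..} F"
    and "\<And>b h. b > 0 \<Longrightarrow> h > 0 \<Longrightarrow>
           ((\<lambda>\<delta>. crossing_prob pc_star \<delta> b h 0) \<longlongrightarrow> F (b / h)) (at_right 0)"
  shows "\<forall>b>0. \<forall>h>0.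
           ((\<lambda>\<delta>. crossing_prob_limit pc_star \<delta> b h) \<longlongrightarrow> F (b / h)) (at_right 0)"
proof (intro allI impI)
  fix b h :: real
  assume bh: "b > 0" "h > 0"
  let ?M = "bernoulli_config pc_star"
  interpret prob_space ?M by (rule prob_space_bernoulli_config)
  show "((\<lambda>\<delta>. crossing_prob_limit pc_star \<delta> b h) \<longlongrightarrow> F (b / h)) (at_right 0)"
  proof (rule order_tendstoI)
    fix a assume "a < F (b / h)"
    then have "\<forall>\<^sub>F \<delta> in at_right 0. a < crossing_prob pc_star \<delta> b h 0"
      using assms(2)[OF bh] by (auto dest: order_tendstoD)
    then show "\<forall>\<^sub>F \<delta> in at_right 0. a < crossing_prob_limit pc_star \<delta> b h"
      by (rule eventually_mono) (use crossing_prob_le_limit less_le_trans in blast)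
  next
    fix a assume a: "F (b / h) < a"
    have "isCont F (b / h)"
      using assms(1) bh by (simp add: continuous_on_eq_continuous_at)
    moreover have "((\<lambda>\<epsilon>. (b + \<epsilon>) / (h - \<epsilon>)) \<longlongrightarrow> (b + 0) / (h - 0)) (at_right 0)"
      using bh by (intro tendsto_intros) auto
    ultimately have "((\<lambda>\<epsilon>. F ((b + \<epsilon>) / (h - \<epsilon>))) \<longlongrightarrow> F (b / h)) (at_right 0)"
      by (intro isCont_tendsto_compose[of "b / h" F]) auto
    then have "\<forall>\<^sub>F \<epsilon> in at_right 0. F ((b + \<epsilon>) / (h - \<epsilon>)) < a"
      using a by (rule order_tendstoD(2))
    moreover have "\<forall>\<^sub>F \<epsilon> in at_right 0. 0 < \<epsilon> \<and> \<epsilon> < h"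
      using bh by (intro eventually_at_rightI[of 0 h]) auto
    ultimately have "\<forall>\<^sub>F \<epsilon> in at_right 0. F ((b + \<epsilon>) / (h - \<epsilon>)) < a \<and> 0 < \<epsilon> \<and> \<epsilon> < h"
      by (rule eventually_conj)
    then obtain \<epsilon> where \<epsilon>: "F ((b + \<epsilon>) / (h - \<epsilon>)) < a" "0 < \<epsilon>" "\<epsilon> < h"
      using eventually_happens[of _ "at_right (0::real)"] by (auto simp: trivial_limit_at_right_real)
    \<comment> \<open>Rerouting over \<open>n \<le> \<epsilon> / (4 * \<delta>)\<close> steps shifts a crossing by at most \<open>\<epsilon> / 4\<close>; together with
      \<open>\<delta> < \<epsilon> / 4\<close> for the sites just outside the rectangle this stays below the margin \<open>\<epsilon> / 2\<close>
      on each side.\<close>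
    let ?B = "\<lambda>\<delta>. late_flip (nat \<lceil>(b + h) / \<delta>\<rceil> + 1) (nat \<lfloor>(\<epsilon>/4) / \<delta>\<rfloor>)"
    have "((\<lambda>\<delta>. crossing_prob pc_star \<delta> (b + \<epsilon>) (h - \<epsilon>) 0 + measure ?M (?B \<delta>))
        \<longlongrightarrow> F ((b + \<epsilon>) / (h - \<epsilon>)) + 0) (at_right 0)"
      using bh \<epsilon> by (intro tendsto_add assms(2) late_flip_prob_tendsto) auto
    then have "\<forall>\<^sub>F \<delta> in at_right 0. crossing_prob pc_star \<delta> (b + \<epsilon>) (h - \<epsilon>) 0 + measure ?M (?B \<delta>) < a"
      using \<epsilon>(1) by (intro order_tendstoD(2)) auto
    moreover have "\<forall>\<^sub>F \<delta> in at_right 0. 0 < \<delta> \<and> \<delta> < \<epsilon> / 4 \<and> \<delta> < h - \<epsilon>"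
      using \<epsilon> by (intro eventually_at_rightI[of 0 "min (\<epsilon>/4) (h - \<epsilon>)"]) auto
    ultimately show "\<forall>\<^sub>F \<delta> in at_right 0. crossing_prob_limit pc_star \<delta> b h < a"
    proof eventually_elim
      case (elim \<delta>)
      let ?K = "nat \<lceil>(b + h) / \<delta>\<rceil> + 1" and ?n = "nat \<lfloor>(\<epsilon>/4) / \<delta>\<rfloor>"
      let ?I = "{\<omega>. vertical_star_crossing \<delta> (b + \<epsilon>) (h - \<epsilon>) \<omega>}"
      have d: "0 < \<delta>" "\<delta> < \<epsilon> / 4" using elim by simp_all
      have "0 \<le> (\<epsilon>/4) / \<delta>" using \<epsilon> d by simp
      then have "real ?n \<le> (\<epsilon>/4) / \<delta>" by linarith
      then have n: "\<delta> * real ?n \<le> \<epsilon> / 4"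
        using pos_le_divide_eq[OF d(1), of "real ?n" "\<epsilon>/4"] by (simp only: mult.commute)
      have bhd: "0 \<le> b / \<delta>" "0 \<le> h / \<delta>" using bh d by simp_all
      have K': "b / \<delta> + h / \<delta> + 1 \<le> real ?K"
        unfolding add_divide_distrib[symmetric] by linarith
      have K: "b / (2 * \<delta>) + 1 \<le> real ?K" "h / (2 * \<delta>) + 1 \<le> real ?K"
      proof -
        have "b / (2 * \<delta>) = (b / \<delta>) / 2" "h / (2 * \<delta>) = (h / \<delta>) / 2" by simp_all
        then show "b / (2 * \<delta>) + 1 \<le> real ?K" "h / (2 * \<delta>) + 1 \<le> real ?K"
          using K' bhd by linarith+
      qed
      have "{\<omega>. vertical_star_crossing \<delta> b h (bootstrap_limit \<omega>)} \<subseteq> ?I \<union> ?B \<delta>"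
      proof (intro subsetI)
        fix \<omega> assume "\<omega> \<in> {\<omega>. vertical_star_crossing \<delta> b h (bootstrap_limit \<omega>)}"
        then have cr: "vertical_star_crossing \<delta> b h (bootstrap_limit \<omega>)" by simp
        show "\<omega> \<in> ?I \<union> ?B \<delta>"
        proof (cases "\<omega> \<in> ?B \<delta>")
          case False
          have "vertical_star_crossing \<delta> (b + \<epsilon>) (h - \<epsilon>) \<omega>"
          proof (rule limit_crossing_initial_crossing[OF cr False d(1) _ K])
            have "\<delta> * (real ?n + 1) \<le> \<epsilon> / 4 + \<delta>" using n by (simp add: distrib_left)
            moreover have "b / 2 + (\<epsilon> / 4 + \<delta>) < (b + \<epsilon>) / 2" using d(2) by simp
            ultimately show "b / 2 + \<delta> * (real ?n + 1) < (b + \<epsilon>) / 2"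
              by (meson add_left_mono order_le_less_trans)
            show "(h - \<epsilon>) / 2 \<le> h / 2 - \<delta> * real ?n"
              by (rule order_trans[OF _ diff_left_mono[OF n]]) (use \<epsilon> in simp)
          qed (use elim in simp)
          then show ?thesis by simp
        qed simp
      qed
      moreover have BM: "?B \<delta> \<in> sets ?M"
        by (rule prob_flips_exponential[of pc_star]) (rule late_flip_prob(1))
      ultimately have "crossing_prob_limit pc_star \<delta> b h \<le> measure ?M (?I \<union> ?B \<delta>)"
        unfolding crossing_prob_limit_def using crossing_sets(1)
        by (intro finite_measure_mono) auto
      also have "\<dots> \<le> measure ?M ?I + measure ?M (?B \<delta>)"
        using BM crossing_sets(1) by (intro measure_Un_le)
      also have "measure ?M ?I = crossing_prob pc_star \<delta> (b + \<epsilon>) (h - \<epsilon>) 0"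
        by (simp add: crossing_prob_def)
      finally show ?case using elim by linarith
    qed
  qed
qed

end
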